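(* Let $T$ be an infinite rooted tree without leaves (except possibly at the root), and let $\mu\neq\nu$ be probability measures on a finite set $\Omega$ with $\mu(\omega)>0$ and $\nu(\omega)>0$ for all $\omega\in\Omega$. For a Borel probability measure $\Psi$ on $\partial T$, let $P=\mu^{V(T)}$ and $Q=Q_\Psi$ be the associated measures on $\Omega^{V(T)}$. (1) If $\log \mathrm{br}(T)<H(\nu|\mu)$, then $P$ and $Q_\Psi$ are singular for every probability measure $\Psi$ on $\partial T$. (2) If $\log \mathrm{br}(T)>H(\nu|\mu)$, then there exists a probability measure $\Psi$ on $\partial T$ such that $P$ and $Q_\Psi$ are indistinguishable.
   Context: A ray of $T$ is an infinite self-avoiding path starting at the root; the boundary $\partial T$ is the set of all rays, with the Borel $\sigma$-algebra generated by the sets $\Upsilon(v)$, $v\in V(T)$, where $\Upsilon(v)$ is the set of rays going through $v$. For a Borel measure $\Psi$ on $\partial T$ write $\Psi(v)=\Psi(\Upsilon(v))$. For a ray $\mathcal X$, $[\mathcal X]$ denotes its set of vertices. $P=\mu^{V(T)}$ is the product measure, and $Q_\Psi=\int_{\partial T}\nu^{[\mathcal X]}\times\mu^{V(T)\setminus[\mathcal X]}\,d\Psi(\mathcal X)$, i.e. labels are independent given $\mathcal X$, with law $\nu$ on $[\mathcal X]$ and law $\mu$ off $[\mathcal X]$. Two measures are called indistinguishable if they are absolutely continuous with respect to each other. The relative entropy is $H(\nu|\mu)=\sum_{\rho\in\Omega}\nu(\rho)\log\left(\frac{\nu(\rho)}{\mu(\rho)}\right)$. The branching number $\mathrm{br}(T)$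 is the supremum of all $\beta$ such that there exists a probability measure $\Psi_\beta$ on $\partial T$ with $\sup_{v\in V(T)}\beta^{|v|}\Psi_\beta(v)<\infty$, where $|v|$ is the distance from $v$ to the root. *)

theory Defs
  imports "HOL-Probability.Probability"
begin

record 'a rooted_graph =
  verts :: "'a set"
  adj :: "'a \<Rightarrow> 'a \<Rightarrow> bool"
  root :: 'a

definition walk :: "'a rooted_graph \<Rightarrow> 'a list \<Rightarrow> bool" where
  "walk T p \<longleftrightarrow> p \<noteq> [] \<and> set p \<subseteq> verts T \<and> successively (adj T) p"

text \<open>
  A simple graph with a distinguished vertex that is connected and has no cycle. Neither
  countability nor local finiteness is required. The predicate \<open>tree\<close> of the AFP entry
  \<open>Graph_Theory\<close> excludes directed cycles only; an undirected edge given by two opposite arcs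
  is already such a cycle, so it does not describe undirected trees.
\<close>

definition rooted_tree :: "'a rooted_graph \<Rightarrow> bool" where
  "rooted_tree T \<longleftrightarrow>
     root T \<in> verts T \<and>
     (\<forall>u v. adj T u v \<longrightarrow> u \<in> verts T \<and> v \<in> verts T \<and> u \<noteq> v \<and> adj T v u) \<and>
     (\<forall>u\<in>verts T. \<forall>v\<in>verts T. \<exists>p. walk T p \<and> hd p = u \<and> last p = v) \<and>
     (\<nexists>c. walk T c \<and> distinct c \<and> length c \<ge> 3 \<and> adj T (last c) (hd c))"

text \<open>A leaf is a vertex of degree one.\<close>

definition leaf :: "'a rooted_graph \<Rightarrow> 'a \<Rightarrow> bool" where
  "leaf T v \<longleftrightarrow> v \<in> verts T \<and> (\<exists>!w. adj T v w)"

text \<open>The graph distance of a vertex from the root, written \<open>|v|\<close> in the literature.\<close>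

definition depth :: "'a rooted_graph \<Rightarrow> 'a \<Rightarrow> nat" where
  "depth T v = (LEAST n. \<exists>p. walk T p \<and> hd p = root T \<and> last p = v \<and> length p = Suc n)"

definition rays :: "'a rooted_graph \<Rightarrow> (nat \<Rightarrow> 'a) set" where
  "rays T = {X. X 0 = root T \<and> (\<forall>n. adj T (X n) (X (Suc n))) \<and> inj X}"

definition rays_through :: "'a rooted_graph \<Rightarrow> 'a \<Rightarrow> (nat \<Rightarrow> 'a) set" where
  "rays_through T v = {X \<in> rays T. v \<in> range X}"

text \<open>
  Only the measurable space matters here (the measure carried by \<^const>\<open>sigma\<close> is zero); the
  probability measures on it are the elements of \<open>space (prob_algebra (boundary T))\<close>.
\<close>

definition boundary :: "'a rooted_graph \<Rightarrow> (nat \<Rightarrow> 'a) measure" where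
  "boundary T = sigma (rays T) (rays_through T ` verts T)"

definition branching_number :: "'a rooted_graph \<Rightarrow> ereal" where
  "branching_number T =
     Sup (ereal ` {\<beta>. 0 < \<beta> \<and> (\<exists>\<Psi> \<in> space (prob_algebra (boundary T)).
       bdd_above ((\<lambda>v. \<beta> ^ depth T v * measure \<Psi> (rays_through T v)) ` verts T))})"

text \<open>The branching number may be infinite, so its logarithm is taken in the extended reals.\<close>

definition ln_ereal :: "ereal \<Rightarrow> ereal" where
  "ln_ereal x = (if x = \<infinity> then \<infinity> else if x \<le> 0 then -\<infinity> else ereal (ln (real_of_ereal x)))"

definition relative_entropy :: "'o::finite pmf \<Rightarrow> 'o pmf \<Rightarrow> real" where
  "relative_entropy \<nu> \<mu> = (\<Sum>\<rho>\<in>UNIV. pmf \<nu> \<rho> * ln (pmf \<nu> \<rho> / pmf \<mu> \<rho>))"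

definition background_law :: "'a rooted_graph \<Rightarrow> 'o pmf \<Rightarrow> ('a \<Rightarrow> 'o) measure" where
  "background_law T \<mu> = Pi\<^sub>M (verts T) (\<lambda>_. measure_pmf \<mu>)"

text \<open>The law of the labels given the ray \<open>X\<close>, whose vertex set is \<open>range X\<close>.\<close>

definition labels_given_ray ::
  "'a rooted_graph \<Rightarrow> 'o pmf \<Rightarrow> 'o pmf \<Rightarrow> (nat \<Rightarrow> 'a) \<Rightarrow> ('a \<Rightarrow> 'o) measure" where
  "labels_given_ray T \<mu> \<nu> X =
     Pi\<^sub>M (verts T) (\<lambda>v. if v \<in> range X then measure_pmf \<nu> else measure_pmf \<mu>)"

definition hidden_ray_law ::
  "'a rooted_graph \<Rightarrow> 'o pmf \<Rightarrow> 'o pmf \<Rightarrow> (nat \<Rightarrow> 'a) measure \<Rightarrow> ('a \<Rightarrow> 'o) measure" where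
  "hidden_ray_law T \<mu> \<nu> \<Psi> = \<Psi> \<bind> labels_given_ray T \<mu> \<nu>"

definition mutually_singular :: "'b measure \<Rightarrow> 'b measure \<Rightarrow> bool" where
  "mutually_singular M N \<longleftrightarrow>
     (\<exists>A\<in>sets M. emeasure M A = 0 \<and> emeasure N (space M - A) = 0)"

definition indistinguishable :: "'b measure \<Rightarrow> 'b measure \<Rightarrow> bool" where
  "indistinguishable M N \<longleftrightarrow> absolutely_continuous M N \<and> absolutely_continuous N M"

text \<open>
  The monadic bind denotes the intended mixture only if the conditional law is a measurable
  kernel, which holds; \<open>emeasure_hidden_ray_law\<close> below is the defining integral.
\<close>

lemma space_boundary: "space (boundary T) = rays T"
  unfolding boundary_def by (rule space_measure_of) (auto simp: rays_through_def)

lemma rays_through_in_sets: "v \<in> verts T \<Longrightarrow> rays_through T v \<in> sets (boundary T)"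
  unfolding boundary_def by (subst sets_measure_of) (auto simp: rays_through_def)

lemma sets_labels_given_ray: "sets (labels_given_ray T \<mu> \<nu> X) = sets (background_law T \<mu>)"
  unfolding labels_given_ray_def background_law_def by (intro sets_PiM_cong) auto

lemma measurable_labels_given_ray:
  "labels_given_ray T \<mu> \<nu> \<in> boundary T \<rightarrow>\<^sub>M prob_algebra (background_law T \<mu>)"
proof (rule measurable_prob_algebra_generated)
  let ?G = "prod_algebra (verts T) (\<lambda>_. measure_pmf \<mu>)"
  let ?S = "\<Pi>\<^sub>E v\<in>verts T. space (measure_pmf \<mu>)"
  show "sets (background_law T \<mu>) = sigma_sets ?S ?G"
    unfolding background_law_def by (rule sets_PiM)
  show "Int_stable ?G" by (rule Int_stable_prod_algebra)
  show "?G \<subseteq> Pow ?S" by (rule prod_algebra_sets_into_space)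
  show "prob_space (labels_given_ray T \<mu> \<nu> X)" for X
    unfolding labels_given_ray_def by (intro prob_space_PiM) (auto intro: measure_pmf.prob_space_axioms)
  show "sets (labels_given_ray T \<mu> \<nu> X) = sets (background_law T \<mu>)" for X
    by (rule sets_labels_given_ray)
  fix A assume "A \<in> ?G"
  then obtain J F where A: "A = prod_emb (verts T) (\<lambda>_. measure_pmf \<mu>) J (Pi\<^sub>E J F)"
    and J: "finite J" "J \<subseteq> verts T"
    by (elim prod_algebraE) auto
  have eq: "emeasure (labels_given_ray T \<mu> \<nu> X) A =
      (\<Prod>v\<in>J. if v \<in> range X then emeasure (measure_pmf \<nu>) (F v) else emeasure (measure_pmf \<mu>) (F v))" for X
  proof -
    let ?M = "\<lambda>v. if v \<in> range X then measure_pmf \<nu> else measure_pmf \<mu>"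
    have "A = prod_emb (verts T) ?M J (Pi\<^sub>E J F)"
      unfolding A by (auto simp: prod_emb_def)
    moreover have "emeasure (Pi\<^sub>M (verts T) ?M) (prod_emb (verts T) ?M J (Pi\<^sub>E J F))
        = (\<Prod>v\<in>J. emeasure (?M v) (F v))"
      using J by (intro emeasure_PiM_emb) (simp_all add: measure_pmf.prob_space_axioms)
    ultimately show ?thesis
      unfolding labels_given_ray_def by (auto intro!: prod.cong)
  qed
  have [measurable]: "Measurable.pred (boundary T) (\<lambda>X. v \<in> range X)" if "v \<in> J" for v
    unfolding pred_def using rays_through_in_sets[of v T] that J
    by (simp add: space_boundary rays_through_def subset_eq)
  show "(\<lambda>X. emeasure (labels_given_ray T \<mu> \<nu> X) A) \<in> borel_measurable (boundary T)"
    unfolding eq by measurable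
qed

lemma emeasure_hidden_ray_law:
  assumes "\<Psi> \<in> space (prob_algebra (boundary T))" and "A \<in> sets (background_law T \<mu>)"
  shows "emeasure (hidden_ray_law T \<mu> \<nu> \<Psi>) A = (\<integral>\<^sup>+X. emeasure (labels_given_ray T \<mu> \<nu> X) A \<partial>\<Psi>)"
  unfolding hidden_ray_law_def
  by (rule emeasure_bind_prob_algebra[OF assms(1) measurable_labels_given_ray assms(2)])

lemma sets_hidden_ray_law:
  assumes "\<Psi> \<in> space (prob_algebra (boundary T))"
  shows "sets (hidden_ray_law T \<mu> \<nu> \<Psi>) = sets (background_law T \<mu>)"
  unfolding hidden_ray_law_def
  by (rule sets_bind'[OF assms measurable_labels_given_ray])

end

theory Submission
  imports Defs
begin

text \<open>
  Write \<open>H\<close> for the relative entropy and \<open>W\<^sub>n(X)\<close> for the product of the likelihood ratios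
  \<open>\<nu>(\<sigma> v)/\<mu>(\<sigma> v)\<close> over the first \<open>n\<close> vertices of a ray \<open>X\<close>. Under \<open>P\<close> it has mean one; under the
  law with \<open>X\<close> planted, Hoeffding's inequality shows that it is \<open>exp (n (H + o(1)))\<close>
  (\<open>planted_likelihood_concentration\<close>). Two rays share an initial segment and nothing else, because
  paths in a tree are unique (\<open>rays_meet\<close>).

  Below the threshold, choose \<open>\<beta>\<close> with \<open>br(T) < \<beta> < exp H\<close>. Almost every ray meets infinitely many
  vertices \<open>v\<close> with \<open>\<Psi>(v) > \<beta>\<^sup>-\<^sup>|\<^sup>v\<^sup>|\<close>, since otherwise \<open>\<Psi>\<close> conditioned on the exceptional rays would
  witness \<open>br(T) \<ge> \<beta>\<close>. There are at most \<open>\<beta>\<^sup>n\<close> such vertices at level \<open>n\<close>, and under \<open>P\<close> each of them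
  sees a likelihood as large as \<open>exp (n (H - \<epsilon>))\<close> with probability at most \<open>exp (- n (H - \<epsilon>))\<close>. By the
  Borel-Cantelli lemma, large likelihoods at such vertices occur infinitely often under \<open>Q\<close> but not
  under \<open>P\<close>.

  Above the threshold, choose \<open>\<beta> > exp H\<close> and \<open>\<Psi>\<close> with \<open>\<Psi>(v) \<le> C \<beta>\<^sup>-\<^sup>|\<^sup>v\<^sup>|\<close>. Given the planted ray \<open>X\<close>
  and typical labels along it, the mean of the density of \<open>Q\<close> is at most about
  \<open>\<Sum>k. W\<^sub>k(X) \<Psi>(X\<^sub>k)\<close>, which a geometric series dominates. So the density is tight under \<open>Q\<close>, uniformly
  over the finite sets of vertices that are observed (\<open>hidden_ray_law_cylinder_le\<close>), and \<open>Q\<close> is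
  absolutely continuous with respect to \<open>P\<close>. Working with finite sets of vertices instead of levels
  keeps the argument valid for trees of any cardinality.

  Conversely, as both letter laws charge every letter, relabelling a vertex maps \<open>Q\<close>-null sets to
  \<open>Q\<close>-null sets. The zero set of the density is then a tail event up to null sets, so it has
  \<open>P\<close>-measure zero or one, and it cannot be one (\<open>absolutely_continuous_background_law\<close>).
\<close>

section \<open>Rays of a tree\<close>

text \<open>
  If two self-avoiding paths with common endpoints split right after a common vertex, following the
  first one until it meets the second again and returning along the second closes a cycle.
\<close>

lemma self_avoiding_path_unique:
  assumes T: "rooted_tree T"
    and "walk T p" "walk T q" "distinct p" "distinct q" "hd p = hd q" "last p = last q"
  shows "p = q"
  using assms(2-)
proof (induction p arbitrary: q)
  case Nil
  then show ?case by (simp add: walk_def)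
next
  case (Cons u p q)
  from Cons.prems obtain q' where q: "q = u # q'"
    by (cases q) (auto simp: walk_def)
  have sym: "adj T x y \<Longrightarrow> adj T y x" for x y
    using T by (auto simp: rooted_tree_def)
  show ?case
  proof (cases "p = [] \<or> q' = []")
    case True
    then show ?thesis
      using Cons.prems q by (auto split: if_splits)
  next
    case False
    then obtain a p1 b q1 where ab: "p = a # p1" "q' = b # q1"
      by (metis list.exhaust)
    show ?thesis
    proof (cases "a = b")
      case True
      have "p = q'"
        by (rule Cons.IH) (use Cons.prems q ab True in \<open>auto simp: walk_def\<close>)
      then show ?thesis using q by simp
    next
      case ne: False
      have "\<exists>x\<in>set p. x \<in> set q'"
        using Cons.prems(6) q ab by (metis False last.simps last_in_set)
      then obtain ys x zs where p: "p = ys @ x # zs" "x \<in> set q'" "\<forall>y\<in>set ys. y \<notin> set q'"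
        by (rule split_list_first_propE)
      then obtain us vs where q': "q' = us @ x # vs"
        by (meson split_list)
      define c where "c = u # ys @ x # rev us"
      have "distinct c"
        using Cons.prems p q' q unfolding c_def by auto
      moreover have "walk T c"
      proof -
        have "successively (adj T) (u # ys @ [x])"
          using Cons.prems(1) p by (auto simp: walk_def successively_append_iff successively_Cons hd_append split: if_splits)
        moreover have "successively (adj T) (us @ [x])"
          using Cons.prems(2) q q'
          by (auto simp: walk_def successively_append_iff successively_Cons)
        then have "successively (adj T) (rev (us @ [x]))"
          unfolding successively_rev by (rule successively_mono) (auto intro: sym)
        ultimately show ?thesis
          using Cons.prems(1,2) p q q' unfolding c_def walk_def
          by (auto simp: successively_append_iff successively_Cons hd_append split: if_splits)
      qed
      moreover have "length c \<ge> 3"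
        using p q' ab ne unfolding c_def by (cases ys; cases us) auto
      moreover have "adj T (last c) (hd c)"
      proof -
        have "last c = b" using q' ab unfolding c_def by (cases us) auto
        moreover have "adj T u b" using Cons.prems(2) q ab by (simp add: walk_def)
        ultimately show ?thesis by (simp add: c_def sym)
      qed
      ultimately have False
        using T unfolding rooted_tree_def by blast
      then show ?thesis ..
    qed
  qed
qed

lemma ray_in_verts:
  assumes "rooted_tree T" "X \<in> rays T"
  shows "X n \<in> verts T" "range X \<subseteq> verts T"
proof -
  show "X n \<in> verts T" for n
    using assms by (auto simp: rays_def rooted_tree_def)
  then show "range X \<subseteq> verts T" by auto
qed

lemma ray_prefix:
  assumes "rooted_tree T" "X \<in> rays T"
  shows "walk T (map X [0..<Suc n])" "distinct (map X [0..<Suc n])"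
    "hd (map X [0..<Suc n]) = root T" "last (map X [0..<Suc n]) = X n"
proof -
  have "successively (adj T) (map X [0..<Suc n])"
    using assms(2) by (induction n) (auto simp: rays_def successively_append_iff)
  then show "walk T (map X [0..<Suc n])"
    using ray_in_verts[OF assms] by (auto simp: walk_def)
  show "distinct (map X [0..<Suc n])"
    using assms(2) by (auto simp: rays_def distinct_map simp del: upt_Suc intro: inj_on_subset)
  show "hd (map X [0..<Suc n]) = root T"
    using assms(2) by (simp add: rays_def hd_map del: upt_Suc)
qed simp

lemma rays_meet:
  assumes T: "rooted_tree T" and X: "X \<in> rays T" and Y: "Y \<in> rays T" and eq: "X i = Y j"
  shows "i = j" and "k \<le> i \<Longrightarrow> X k = Y k"
proof -
  have *: "map X [0..<Suc i] = map Y [0..<Suc j]"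
    using ray_prefix[OF T X, of i] ray_prefix[OF T Y, of j] eq
    by (intro self_avoiding_path_unique[OF T]) auto
  from arg_cong[OF this, of length] show "i = j" by simp
  with * show "X k = Y k" if "k \<le> i"
    using that by (simp add: list_eq_iff_nth_eq del: upt_Suc)
qed

lemma rays_through_iff:
  assumes "rooted_tree T" "X \<in> rays T" "Y \<in> rays T"
  shows "Y \<in> rays_through T (X n) \<longleftrightarrow> Y n = X n"
proof
  assume "Y \<in> rays_through T (X n)"
  then obtain k where "X n = Y k" by (auto simp: rays_through_def)
  with rays_meet(1)[OF assms this] show "Y n = X n" by simp
next
  assume "Y n = X n"
  then show "Y \<in> rays_through T (X n)"
    using assms(3) rangeI[of Y n] by (simp add: rays_through_def)
qed

text \<open>A shortest walk avoids itself, so it is the initial segment of the ray.\<close>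

lemma depth_ray:
  assumes T: "rooted_tree T" and X: "X \<in> rays T"
  shows "depth T (X n) = n"
proof -
  let ?P = "\<lambda>m. \<exists>p. walk T p \<and> hd p = root T \<and> last p = X n \<and> length p = Suc m"
  have "?P n"
    using ray_prefix[OF T X, of n] by (intro exI[of _ "map X [0..<Suc n]"]) simp
  then have "?P (depth T (X n))"
    unfolding depth_def by (rule LeastI)
  then obtain p where p: "walk T p" "hd p = root T" "last p = X n" "length p = Suc (depth T (X n))"
    by blast
  have "distinct p"
  proof (rule ccontr)
    assume "\<not> distinct p"
    then obtain xs y ys zs where d: "p = xs @ [y] @ ys @ [y] @ zs"
      using not_distinct_decomp by blast
    define q where "q = xs @ [y] @ zs"
    have "walk T q" "hd q = root T" "last q = X n"
      using p d unfolding q_def walk_def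
      by (auto simp: successively_append_iff successively_Cons hd_append split: if_splits)
    moreover have "length q = Suc (length xs + length zs)" "length xs + length zs < depth T (X n)"
      using p(4) d unfolding q_def by auto
    ultimately show False
      using not_less_Least[of "length xs + length zs" ?P] unfolding depth_def by blast
  qed
  then have "p = map X [0..<Suc n]"
    using p ray_prefix[OF T X, of n] by (intro self_avoiding_path_unique[OF T]) auto
  with p(4) show ?thesis by simp
qed

text \<open>
  Finite sets of vertices may be enlarged so as to meet each ray in an initial segment: add the
  ancestors of every vertex that lies on some ray.
\<close>

definition ray_closed :: "'a rooted_graph \<Rightarrow> 'a set \<Rightarrow> bool" where
  "ray_closed T J \<longleftrightarrow> (\<forall>X\<in>rays T. \<forall>k. X k \<in> J \<longrightarrow> X ` {..k} \<subseteq> J)"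

lemma finite_subset_ray_closed:
  assumes T: "rooted_tree T" and J: "finite J" "J \<subseteq> verts T"
  obtains J' where "finite J'" "J \<subseteq> J'" "J' \<subseteq> verts T" "ray_closed T J'"
proof -
  have "\<exists>A. finite A \<and> v \<in> A \<and> A \<subseteq> verts T \<and> ray_closed T A" if v: "v \<in> verts T" for v
  proof (cases "\<exists>Y\<in>rays T. \<exists>n. Y n = v")
    case False
    then show ?thesis
      by (intro exI[of _ "{v}"]) (auto simp: ray_closed_def v)
  next
    case True
    then obtain Y n where Y: "Y \<in> rays T" "Y n = v" by blast
    have "ray_closed T (Y ` {..n})"
      unfolding ray_closed_def
    proof (intro ballI allI impI)
      fix X k assume X: "X \<in> rays T" and "X k \<in> Y ` {..n}"
      then obtain j where j: "X k = Y j" "j \<le> n" by auto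
      have "k = j" by (rule rays_meet(1)[OF T X Y(1) j(1)])
      with rays_meet(2)[OF T X Y(1) j(1)] j show "X ` {..k} \<subseteq> Y ` {..n}"
        by (auto intro!: imageI)
    qed
    then show ?thesis
      using Y ray_in_verts[OF T Y(1)] by (intro exI[of _ "Y ` {..n}"]) auto
  qed
  then obtain A where A: "\<And>v. v \<in> verts T \<Longrightarrow> finite (A v) \<and> v \<in> A v \<and> A v \<subseteq> verts T \<and> ray_closed T (A v)"
    by metis
  show ?thesis
    using J A by (intro that[of "\<Union>v\<in>J. A v"]) (auto simp: ray_closed_def, blast+)
qed

lemma ray_closed_segment:
  assumes T: "rooted_tree T" and X: "X \<in> rays T" and Y: "Y \<in> rays T"
    and J: "finite J" "ray_closed T J"
  obtains m where "J \<inter> range X \<inter> range Y = X ` {..<m}"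
proof -
  define N where "N = {k. X k \<in> J \<and> X k \<in> range Y}"
  have "finite (X ` N)"
    by (rule finite_subset[OF _ J(1)]) (auto simp: N_def)
  moreover have "inj_on X N"
    using X by (auto simp: rays_def intro: inj_on_subset)
  ultimately have "finite N"
    by (rule finite_imageD)
  have down: "i \<in> N" if "k \<in> N" "i \<le> k" for i k
  proof -
    have k: "X k \<in> J" "X k = Y k"
      using that rays_meet(1)[OF T X Y] by (auto simp: N_def)
    have "X i \<in> J"
      using J(2) X k(1) that(2) unfolding ray_closed_def by blast
    moreover have "X i = Y i"
      by (rule rays_meet(2)[OF T X Y k(2) that(2)])
    ultimately show ?thesis by (simp add: N_def)
  qed
  have "N = {..<card N}"
  proof (cases "N = {}")
    case False
    then have "N = {..Max N}"
      using \<open>finite N\<close> down[OF Max_in[OF \<open>finite N\<close>]] by (auto intro: Max_ge)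
    then show ?thesis by (metis card_atMost lessThan_Suc_atMost)
  qed simp
  moreover have "J \<inter> range X \<inter> range Y = X ` N"
    unfolding N_def by blast
  ultimately show ?thesis
    using that by metis
qed

section \<open>Product measures and finite sets of coordinates\<close>

lemma (in product_prob_space) nn_integral_PiM_prod:
  assumes J: "finite J" "J \<subseteq> I"
    and f [measurable]: "\<And>i. i \<in> J \<Longrightarrow> f i \<in> borel_measurable (M i)"
  shows "(\<integral>\<^sup>+\<sigma>. (\<Prod>i\<in>J. f i (\<sigma> i)) \<partial>Pi\<^sub>M I M) = (\<Prod>i\<in>J. integral\<^sup>N (M i) (f i))"
proof -
  interpret J: finite_product_prob_space M J
    by standard (fact J(1))
  have "(\<Prod>i\<in>J. integral\<^sup>N (M i) (f i)) = (\<integral>\<^sup>+\<sigma>. (\<Prod>i\<in>J. f i (\<sigma> i)) \<partial>Pi\<^sub>M J M)"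
    using J by (intro product_nn_integral_prod[symmetric]) auto
  also have "\<dots> = (\<integral>\<^sup>+\<sigma>. (\<Prod>i\<in>J. f i (\<sigma> i)) \<partial>distr (Pi\<^sub>M I M) (Pi\<^sub>M J M) (\<lambda>\<sigma>. restrict \<sigma> J))"
    by (simp add: distr_PiM_restrict_finite[OF J])
  also have "\<dots> = (\<integral>\<^sup>+\<sigma>. (\<Prod>i\<in>J. f i (restrict \<sigma> J i)) \<partial>Pi\<^sub>M I M)"
    by (rule nn_integral_distr) (use J in \<open>auto intro!: measurable_restrict_subset borel_measurable_prod_ennreal\<close>)
  finally show ?thesis by simp
qed

lemma (in product_prob_space) indep_vars_coordinates:
  assumes J: "finite J" "J \<subseteq> I" and f: "\<And>i. i \<in> J \<Longrightarrow> f i \<in> M i \<rightarrow>\<^sub>M N i"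
  shows "P.indep_vars N (\<lambda>i \<sigma>. f i (\<sigma> i)) J"
proof (cases "J = {}")
  case True
  then show ?thesis
    by (auto simp: P.indep_vars_def P.indep_sets_def)
next
  case False
  have "P.indep_vars M (\<lambda>i \<sigma>. \<sigma> i) J"
  proof (subst P.indep_vars_iff_distr_eq_PiM'[OF False])
    show "(\<lambda>\<sigma>. \<sigma> i) \<in> Pi\<^sub>M I M \<rightarrow>\<^sub>M M i" if "i \<in> J" for i
      using that J by (auto intro: measurable_component_singleton)
    have "distr (Pi\<^sub>M I M) (M i) (\<lambda>\<sigma>. \<sigma> i) = M i" if "i \<in> J" for i
      using that J by (intro PiM_component) auto
    then have "Pi\<^sub>M J (\<lambda>i. distr (Pi\<^sub>M I M) (M i) (\<lambda>\<sigma>. \<sigma> i)) = Pi\<^sub>M J M"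
      by (intro PiM_cong) auto
    then show "distr (Pi\<^sub>M I M) (Pi\<^sub>M J M) (\<lambda>x. \<lambda>i\<in>J. x i) = Pi\<^sub>M J (\<lambda>i. distr (Pi\<^sub>M I M) (M i) (\<lambda>\<sigma>. \<sigma> i))"
      using distr_PiM_restrict_finite[OF J] by (simp add: restrict_def)
  qed
  then show ?thesis
    by (rule P.indep_vars_compose2) (rule f)
qed

text \<open>
  Separating the coordinate \<open>v\<close> from the others turns the event into a rectangle.
\<close>

lemma (in product_prob_space) emeasure_coordinate_indep:
  assumes v: "v \<in> I" and A: "A \<in> sets (M v)" and E: "E \<in> sets (Pi\<^sub>M I M)"
    and inv: "\<And>\<sigma> a. \<sigma> \<in> space (Pi\<^sub>M I M) \<Longrightarrow> a \<in> space (M v) \<Longrightarrow> \<sigma>(v := a) \<in> E \<longleftrightarrow> \<sigma> \<in> E"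
  shows "emeasure (Pi\<^sub>M I M) {\<sigma> \<in> E. \<sigma> v \<in> A} = emeasure (Pi\<^sub>M I M) E * emeasure (M v) A"
proof -
  let ?I = "I - {v}"
  have I: "insert v ?I = I" using v by auto
  interpret R: product_prob_space M ?I ..
  obtain a where a: "a \<in> space (M v)"
    using M.not_empty by blast
  define E' where "E' = (\<lambda>\<sigma>. \<sigma>(v := a)) -` E \<inter> space (Pi\<^sub>M ?I M)"
  have upd: "(\<lambda>(x, \<sigma>). \<sigma>(v := x)) \<in> M v \<Otimes>\<^sub>M Pi\<^sub>M ?I M \<rightarrow>\<^sub>M Pi\<^sub>M I M"
    using measurable_add_dim[of v ?I M] measurable_compose[OF measurable_pair_swap']
    by (subst (2) I[symmetric]) (auto intro!: measurable_fun_upd[where J="?I"] simp: case_prod_beta)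
  have upda: "(\<lambda>\<sigma>. \<sigma>(v := a)) \<in> Pi\<^sub>M ?I M \<rightarrow>\<^sub>M Pi\<^sub>M I M"
    using measurable_compose[OF measurable_Pair1'[OF a] upd] by simp
  have E' [measurable]: "E' \<in> sets (Pi\<^sub>M ?I M)"
    unfolding E'_def using upda E by (rule measurable_sets)
  have EA: "{\<sigma> \<in> E. \<sigma> v \<in> B} \<in> sets (Pi\<^sub>M I M)" if "B \<in> sets (M v)" for B
  proof -
    have "{\<sigma> \<in> E. \<sigma> v \<in> B} = E \<inter> ((\<lambda>\<sigma>. \<sigma> v) -` B \<inter> space (Pi\<^sub>M I M))"
      using sets.sets_into_space[OF E] by auto
    then show ?thesis
      using E that v by (auto intro!: sets.Int measurable_sets[of _ _ "M v"])
  qed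
  have *: "emeasure (Pi\<^sub>M I M) {\<sigma> \<in> E. \<sigma> v \<in> B} = emeasure (M v) B * emeasure (Pi\<^sub>M ?I M) E'"
    if B: "B \<in> sets (M v)" for B
  proof -
    have D: "Pi\<^sub>M I M = distr (M v \<Otimes>\<^sub>M Pi\<^sub>M ?I M) (Pi\<^sub>M I M) (\<lambda>(x, \<sigma>). \<sigma>(v := x))"
      using distr_pair_PiM_eq_PiM[of ?I M v] M.prob_space_axioms by (simp add: insert_absorb[OF v])
    have "emeasure (Pi\<^sub>M I M) {\<sigma> \<in> E. \<sigma> v \<in> B} =
        emeasure (M v \<Otimes>\<^sub>M Pi\<^sub>M ?I M) ((\<lambda>(x, \<sigma>). \<sigma>(v := x)) -` {\<sigma> \<in> E. \<sigma> v \<in> B} \<inter> space (M v \<Otimes>\<^sub>M Pi\<^sub>M ?I M))"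
      by (subst D) (rule emeasure_distr[OF upd EA[OF B]])
    also have "(\<lambda>(x, \<sigma>). \<sigma>(v := x)) -` {\<sigma> \<in> E. \<sigma> v \<in> B} \<inter> space (M v \<Otimes>\<^sub>M Pi\<^sub>M ?I M) = B \<times> E'"
    proof -
      have "\<sigma>(v := x) \<in> E \<longleftrightarrow> \<sigma>(v := a) \<in> E" if "x \<in> space (M v)" "\<sigma> \<in> space (Pi\<^sub>M ?I M)" for x \<sigma>
        using inv[of "\<sigma>(v := a)" x] measurable_space[OF upda that(2)] that by simp
      then show ?thesis
        using sets.sets_into_space[OF B]
        by (auto simp: E'_def space_pair_measure)
    qed
    also have "emeasure (M v \<Otimes>\<^sub>M Pi\<^sub>M ?I M) (B \<times> E') = emeasure (M v) B * emeasure (Pi\<^sub>M ?I M) E'"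
      by (rule R.P.emeasure_pair_measure_Times[OF B E'])
    finally show ?thesis .
  qed
  have "{\<sigma> \<in> E. \<sigma> v \<in> space (M v)} = E"
    using sets.sets_into_space[OF E] v by (auto simp: space_PiM)
  then have "emeasure (Pi\<^sub>M I M) E = emeasure (Pi\<^sub>M ?I M) E'"
    using *[of "space (M v)"] by (simp add: prob_space.emeasure_space_1[OF M.prob_space_axioms])
  with *[OF A] show ?thesis
    by (simp add: mult.commute)
qed

definition planted :: "'a set \<Rightarrow> 'o pmf \<Rightarrow> 'o pmf \<Rightarrow> 'a set \<Rightarrow> ('a \<Rightarrow> 'o) measure" where
  "planted V \<mu> \<nu> S = Pi\<^sub>M V (\<lambda>v. if v \<in> S then measure_pmf \<nu> else measure_pmf \<mu>)"

lemma labels_given_ray_eq_planted: "labels_given_ray T \<mu> \<nu> X = planted (verts T) \<mu> \<nu> (range X)"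
  by (simp add: labels_given_ray_def planted_def)

lemma background_law_eq_planted: "background_law T \<mu> = planted (verts T) \<mu> \<nu> {}"
  by (simp add: background_law_def planted_def)

lemma product_prob_space_planted:
  "product_prob_space (\<lambda>v. if v \<in> S then measure_pmf \<nu> else measure_pmf \<mu>)"
  by (intro product_prob_spaceI) (auto intro: measure_pmf.prob_space_axioms)

lemma prob_space_planted: "prob_space (planted V \<mu> \<nu> S)"
  unfolding planted_def by (intro prob_space_PiM) (auto intro: measure_pmf.prob_space_axioms)

lemma sets_planted [measurable_cong]:
  "sets (planted V \<mu> \<nu> S) = sets (Pi\<^sub>M V (\<lambda>_. count_space UNIV))"
  unfolding planted_def by (intro sets_PiM_cong) auto

lemma space_planted [simp]: "space (planted V \<mu> \<nu> S) = (\<Pi>\<^sub>E v\<in>V. UNIV)"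
  unfolding planted_def by (simp add: space_PiM if_distrib[of space] cong: if_cong)

lemma planted_cong: "S \<inter> V = S' \<inter> V \<Longrightarrow> planted V \<mu> \<nu> S = planted V \<mu> \<nu> S'"
  unfolding planted_def by (intro PiM_cong) auto

lemma measurable_label:
  assumes "v \<in> V"
  shows "(\<lambda>\<sigma>. f (\<sigma> v)) \<in> borel_measurable (Pi\<^sub>M V (\<lambda>_. count_space UNIV))"
  using assms by (intro measurable_compose[OF measurable_component_singleton]) auto

definition likelihood_ratio :: "'o pmf \<Rightarrow> 'o pmf \<Rightarrow> 'o \<Rightarrow> real" where
  "likelihood_ratio \<nu> \<mu> x = pmf \<nu> x / pmf \<mu> x"

text \<open>
  Planting finitely many further vertices multiplies the law by the product of their likelihood
  ratios; both sides give each finite-dimensional rectangle the same product of integrals.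
\<close>

lemma planted_Un_eq_density:
  fixes \<mu> \<nu> :: "'o::finite pmf"
  assumes J: "finite J" "J \<subseteq> V" "J \<inter> S = {}" and \<mu>: "\<And>x. pmf \<mu> x > 0"
  shows "planted V \<mu> \<nu> (S \<union> J) =
    density (planted V \<mu> \<nu> S) (\<lambda>\<sigma>. \<Prod>v\<in>J. ennreal (likelihood_ratio \<nu> \<mu> (\<sigma> v)))"
    (is "?L = ?R")
proof -
  let ?M = "\<lambda>S v. if v \<in> S then measure_pmf \<nu> else measure_pmf \<mu>"
  let ?C = "\<lambda>_. count_space UNIV :: 'o measure"
  let ?r = "\<lambda>x. ennreal (likelihood_ratio \<nu> \<mu> x)"
  interpret P: product_prob_space "?M S" V by (rule product_prob_space_planted)
  interpret L: prob_space ?L by (rule prob_space_planted)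
  have [measurable]: "(\<lambda>\<sigma>. \<Prod>v\<in>J. ?r (\<sigma> v)) \<in> borel_measurable (planted V \<mu> \<nu> S)"
    unfolding measurable_cong_sets[OF sets_planted refl]
    using J(2) by (intro borel_measurable_prod_ennreal measurable_label) auto
  show ?thesis
  proof (rule measure_eqI_PiM_infinite[where I=V and M="?C"])
    show "sets ?L = sets (Pi\<^sub>M V ?C)" "sets ?R = sets (Pi\<^sub>M V ?C)"
      by (simp_all add: sets_planted)
    show "finite_measure ?L" by (rule L.finite_measure_axioms)
    fix A :: "'a \<Rightarrow> 'o set" and K assume K: "finite K" "K \<subseteq> V"
    let ?B = "prod_emb V ?C K (Pi\<^sub>E K A)"
    have B: "?B = prod_emb V (?M S') K (Pi\<^sub>E K A)" for S'
      by (auto simp: prod_emb_def)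
    have Bs: "?B \<in> sets (planted V \<mu> \<nu> S)"
      unfolding sets_planted using K by (intro sets_PiM_I) auto
    define g where "g v x = (if v \<in> J then ?r x else 1) * (if v \<in> K then indicator (A v) x else 1)" for v x
    have "emeasure ?R ?B = (\<integral>\<^sup>+\<sigma>. (\<Prod>v\<in>J. ?r (\<sigma> v)) * indicator ?B \<sigma> \<partial>planted V \<mu> \<nu> S)"
      using Bs by (intro emeasure_density) auto
    also have "\<dots> = (\<integral>\<^sup>+\<sigma>. (\<Prod>v\<in>J \<union> K. g v (\<sigma> v)) \<partial>planted V \<mu> \<nu> S)"
    proof (intro nn_integral_cong)
      fix \<sigma> assume \<sigma>: "\<sigma> \<in> space (planted V \<mu> \<nu> S)"
      have "(\<Prod>v\<in>K. indicator (A v) (\<sigma> v)) = (indicator ?B \<sigma> :: ennreal)"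
      proof (cases "\<forall>v\<in>K. \<sigma> v \<in> A v")
        case True
        then show ?thesis using \<sigma> K by (auto simp: prod_emb_def)
      next
        case False
        then have "\<exists>v\<in>K. (indicator (A v) (\<sigma> v) :: ennreal) = 0"
          by (metis indicator_simps(2))
        with False show ?thesis
          using K by (auto simp: prod_emb_def PiE_iff intro!: prod_zero)
      qed
      moreover have "(\<Prod>v\<in>J \<union> K. g v (\<sigma> v)) =
          (\<Prod>v\<in>J. ?r (\<sigma> v)) * (\<Prod>v\<in>K. indicator (A v) (\<sigma> v))"
        unfolding g_def prod.distrib using J(1) K(1)
        by (simp add: prod.If_cases Int_absorb1 Int_commute)
      ultimately show "(\<Prod>v\<in>J. ?r (\<sigma> v)) * indicator ?B \<sigma> = (\<Prod>v\<in>J \<union> K. g v (\<sigma> v))"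
        by simp
    qed
    also have "\<dots> = (\<Prod>v\<in>J \<union> K. integral\<^sup>N (?M S v) (g v))"
      unfolding planted_def using J K
      by (intro P.nn_integral_PiM_prod) (auto simp: measurable_cong_sets[OF sets_measure_pmf_count_space refl])
    also have "\<dots> = (\<Prod>v\<in>J \<union> K. if v \<in> K then emeasure (?M (S \<union> J) v) (A v) else 1)"
    proof (intro prod.cong refl)
      fix v assume v: "v \<in> J \<union> K"
      have r: "(\<integral>\<^sup>+x. ?r x * indicator D x \<partial>measure_pmf \<mu>) = emeasure (measure_pmf \<nu>) D" for D
      proof -
        have "(\<integral>\<^sup>+x. ?r x * indicator D x \<partial>measure_pmf \<mu>) = (\<Sum>x\<in>UNIV. ?r x * indicator D x * pmf \<mu> x)"
          by (rule nn_integral_measure_pmf_support) auto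
        also have "\<dots> = (\<Sum>x\<in>D. ennreal (pmf \<nu> x))"
        proof (rule sum.mono_neutral_cong_right)
          show "?r x * indicator D x * pmf \<mu> x = pmf \<nu> x" if "x \<in> D" for x
            using \<mu>[of x] that by (simp add: likelihood_ratio_def flip: ennreal_mult')
        qed auto
        also have "\<dots> = emeasure (measure_pmf \<nu>) D"
          by (simp add: emeasure_measure_pmf_finite)
        finally show ?thesis .
      qed
      show "integral\<^sup>N (?M S v) (g v) = (if v \<in> K then emeasure (?M (S \<union> J) v) (A v) else 1)"
        using v J(3) r[of "A v"] r[of UNIV] measure_pmf.emeasure_space_1[of \<nu>]
          measure_pmf.emeasure_space_1[of \<mu>]
        unfolding g_def by (auto simp del: measure_pmf.emeasure_space_1)
    qed
    also have "\<dots> = (\<Prod>v\<in>K. emeasure (?M (S \<union> J) v) (A v))"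
      using J K by (simp add: prod.If_cases Int_absorb1 Int_commute)
    also have "\<dots> = emeasure ?L ?B"
      unfolding B[of "S \<union> J"] planted_def using K
      by (intro emeasure_PiM_emb[symmetric]) (auto intro: measure_pmf.prob_space_axioms)
    finally show "emeasure ?L ?B = emeasure ?R ?B" ..
  qed
qed

definition cylinder_sets :: "'a set \<Rightarrow> 'a set \<Rightarrow> ('a \<Rightarrow> 'o) set set" where
  "cylinder_sets V J = prod_emb V (\<lambda>_. count_space UNIV) J ` sets (Pi\<^sub>M J (\<lambda>_. count_space UNIV))"

lemma emeasure_planted_cylinder:
  assumes J: "finite J" "J \<subseteq> V" and A: "A \<in> cylinder_sets V J"
  shows "emeasure (planted V \<mu> \<nu> S) A = emeasure (planted V \<mu> \<nu> (J \<inter> S)) A"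
proof -
  let ?M = "\<lambda>S v. if v \<in> S then measure_pmf \<nu> else measure_pmf \<mu>"
  obtain B where A: "A = prod_emb V (\<lambda>_. count_space UNIV) J B"
    and B: "B \<in> sets (Pi\<^sub>M J (\<lambda>_. count_space UNIV))"
    using A unfolding cylinder_sets_def by auto
  have *: "emeasure (planted V \<mu> \<nu> S) A = emeasure (planted J \<mu> \<nu> S) B" for S
  proof -
    interpret P: product_prob_space "?M S" V by (rule product_prob_space_planted)
    have Bs: "B \<in> sets (Pi\<^sub>M J (?M S))"
      using B sets_planted[of J \<mu> \<nu> S] by (simp add: planted_def)
    have "A = prod_emb V (?M S) J B"
      unfolding A by (auto simp: prod_emb_def)
    with P.emeasure_PiM_emb'[OF J(2) J(1) Bs] show ?thesis
      by (simp add: planted_def)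
  qed
  have "planted J \<mu> \<nu> S = planted J \<mu> \<nu> (J \<inter> S)"
    by (rule planted_cong) auto
  with * show ?thesis by simp
qed

lemma cylinder_sets_mono:
  assumes "J \<subseteq> K" "K \<subseteq> V"
  shows "(cylinder_sets V J :: ('a \<Rightarrow> 'o) set set) \<subseteq> cylinder_sets V K"
proof
  fix A :: "('a \<Rightarrow> 'o) set" assume "A \<in> cylinder_sets V J"
  then obtain B where A: "A = prod_emb V (\<lambda>_. count_space UNIV) J B"
    and B: "B \<in> sets (Pi\<^sub>M J (\<lambda>_. count_space UNIV))"
    unfolding cylinder_sets_def by auto
  have "A = prod_emb V (\<lambda>_. count_space UNIV) K (prod_emb K (\<lambda>_. count_space UNIV) J B)"
    unfolding A using assms by simp
  moreover have "prod_emb K (\<lambda>_. count_space UNIV) J B \<in> sets (Pi\<^sub>M K (\<lambda>_. count_space UNIV))"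
    using assms B by (intro measurable_prod_emb) auto
  ultimately show "A \<in> cylinder_sets V K"
    unfolding cylinder_sets_def by blast
qed

lemma cylinder_sets_subset:
  assumes "J \<subseteq> V"
  shows "(cylinder_sets V J :: ('a \<Rightarrow> 'o) set set) \<subseteq> sets (Pi\<^sub>M V (\<lambda>_. count_space UNIV))"
  unfolding cylinder_sets_def using assms by (auto intro: measurable_prod_emb)

lemma cylinder_setsI:
  fixes f :: "('a \<Rightarrow> 'o) \<Rightarrow> ennreal"
  assumes "J \<subseteq> V" and f: "f \<in> borel_measurable (Pi\<^sub>M J (\<lambda>_. count_space UNIV))" and B: "B \<in> sets borel"
  shows "{\<sigma> \<in> \<Pi>\<^sub>E v\<in>V. UNIV. f (restrict \<sigma> J) \<in> B} \<in> cylinder_sets V J"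
proof -
  let ?B = "f -` B \<inter> space (Pi\<^sub>M J (\<lambda>_. count_space UNIV))"
  have "?B \<in> sets (Pi\<^sub>M J (\<lambda>_. count_space UNIV))"
    using f B by (rule measurable_sets)
  moreover have "{\<sigma> \<in> \<Pi>\<^sub>E v\<in>V. UNIV. f (restrict \<sigma> J) \<in> B} = prod_emb V (\<lambda>_. count_space UNIV) J ?B"
    by (auto simp: prod_emb_def space_PiM)
  ultimately show ?thesis
    unfolding cylinder_sets_def by blast
qed

lemma algebra_cylinder_sets:
  fixes V :: "'a set"
  defines "\<A> \<equiv> (\<Union>J\<in>{J. finite J \<and> J \<subseteq> V}. cylinder_sets V J) :: ('a \<Rightarrow> 'o) set set"
  shows "algebra (\<Pi>\<^sub>E v\<in>V. UNIV) \<A>"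
    and "sets (Pi\<^sub>M V (\<lambda>_. count_space UNIV)) = sigma_sets (\<Pi>\<^sub>E v\<in>V. UNIV) \<A>"
proof -
  let ?M = "\<lambda>_::'a. measure_pmf (return_pmf undefined) :: 'o measure"
  interpret product_prob_space ?M V
    by (intro product_prob_spaceI measure_pmf.prob_space_axioms)
  have *: "sets (Pi\<^sub>M J ?M) = sets (Pi\<^sub>M J (\<lambda>_. count_space UNIV))" for J :: "'a set"
    by (intro sets_PiM_cong) auto
  have emb: "prod_emb V ?M J B = prod_emb V (\<lambda>_. count_space UNIV) J B" for J and B :: "('a \<Rightarrow> 'o) set"
    by (auto simp: prod_emb_def)
  have "generator = \<A>"
  proof (intro set_eqI iffI)
    fix A assume "A \<in> generator"
    then show "A \<in> \<A>"
      by (cases rule: generator.cases) (unfold \<A>_def cylinder_sets_def emb *, blast)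
  next
    fix A assume "A \<in> \<A>"
    then obtain J B where "finite J" "J \<subseteq> V" "B \<in> sets (Pi\<^sub>M J ?M)" "A = prod_emb V ?M J B"
      unfolding \<A>_def cylinder_sets_def emb * by blast
    then show "A \<in> generator"
      using generator.intros by blast
  qed
  then show "algebra (\<Pi>\<^sub>E v\<in>V. UNIV) \<A>"
    "sets (Pi\<^sub>M V (\<lambda>_. count_space UNIV)) = sigma_sets (\<Pi>\<^sub>E v\<in>V. UNIV) \<A>"
    using algebra_generator sets_PiM_generator by (simp_all add: space_PiM *)
qed

section \<open>Concentration of the likelihood along a planted path\<close>

definition atypical_labels :: "'a set \<Rightarrow> 'o::finite pmf \<Rightarrow> 'o pmf \<Rightarrow> real \<Rightarrow> 'a set \<Rightarrow> ('a \<Rightarrow> 'o) set" where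
  "atypical_labels V \<mu> \<nu> \<epsilon> J = {\<sigma> \<in> \<Pi>\<^sub>E v\<in>V. UNIV.
     (\<Prod>v\<in>J. likelihood_ratio \<nu> \<mu> (\<sigma> v)) < exp (card J * (relative_entropy \<nu> \<mu> - \<epsilon>)) \<or>
     exp (card J * (relative_entropy \<nu> \<mu> + \<epsilon>)) < (\<Prod>v\<in>J. likelihood_ratio \<nu> \<mu> (\<sigma> v))}"

lemma atypical_labels_sets:
  assumes "J \<subseteq> V"
  shows "atypical_labels V \<mu> \<nu> \<epsilon> J \<in> sets (Pi\<^sub>M V (\<lambda>_. count_space UNIV))"
proof -
  let ?M = "Pi\<^sub>M V (\<lambda>_. count_space UNIV)" and ?W = "\<lambda>\<sigma>. \<Prod>v\<in>J. likelihood_ratio \<nu> \<mu> (\<sigma> v)"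
  have [measurable]: "?W \<in> borel_measurable ?M"
    using assms by (intro borel_measurable_prod measurable_label) auto
  have "{\<sigma> \<in> space ?M. ?W \<sigma> < exp (card J * (relative_entropy \<nu> \<mu> - \<epsilon>)) \<or>
      exp (card J * (relative_entropy \<nu> \<mu> + \<epsilon>)) < ?W \<sigma>} \<in> sets ?M"
    by measurable
  then show ?thesis
    by (simp add: atypical_labels_def space_PiM)
qed

text \<open>
  The logarithm of the likelihood ratio at a planted vertex is a bounded random variable with mean
  equal to the relative entropy, so Hoeffding's inequality applies.
\<close>

lemma planted_likelihood_concentration:
  fixes \<mu> \<nu> :: "'o::finite pmf"
  assumes \<mu>: "\<And>x. pmf \<mu> x > 0" and \<nu>: "\<And>x. pmf \<nu> x > 0" and \<epsilon>: "\<epsilon> > 0"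
  shows "\<exists>c>0::real. \<forall>V S (J :: 'a set). finite J \<longrightarrow> J \<subseteq> S \<longrightarrow> J \<subseteq> V \<longrightarrow>
    measure (planted V \<mu> \<nu> S) (atypical_labels V \<mu> \<nu> \<epsilon> J) \<le> 2 * exp (- c * card J)"
proof -
  let ?r = "likelihood_ratio \<nu> \<mu>" and ?H = "relative_entropy \<nu> \<mu>"
  have r: "?r x > 0" for x
    using \<mu>[of x] \<nu>[of x] by (simp add: likelihood_ratio_def)
  define B where "B = 1 + (\<Sum>x\<in>UNIV. \<bar>ln (?r x)\<bar>)"
  have B: "\<bar>ln (?r x)\<bar> \<le> B" for x
    unfolding B_def using member_le_sum[of x UNIV "\<lambda>x. \<bar>ln (?r x)\<bar>"] by simp
  have B0: "B > 0"
    unfolding B_def by (intro add_pos_nonneg sum_nonneg) auto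
  define c where "c = \<epsilon>\<^sup>2 / (2 * B\<^sup>2)"
  have c0: "c > 0" using \<epsilon> B0 by (simp add: c_def)
  have bound: "measure (planted V \<mu> \<nu> S) (atypical_labels V \<mu> \<nu> \<epsilon> J) \<le> 2 * exp (- c * card J)"
    (is "measure ?L ?D \<le> _")
    if J: "finite J" "J \<subseteq> S" "J \<subseteq> V" for V S and J :: "'a set"
  proof (cases "J = {}")
    case True
    then show ?thesis
      using prob_space.prob_le_1[OF prob_space_planted, of V \<mu> \<nu> S ?D] by simp
  next
    case False
    let ?M = "\<lambda>v. if v \<in> S then measure_pmf \<nu> else measure_pmf \<mu>"
    interpret P: product_prob_space ?M V by (rule product_prob_space_planted)
    interpret L: prob_space ?L by (rule prob_space_planted)
    have L: "?L = Pi\<^sub>M V ?M" by (simp add: planted_def)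
    have mean: "L.expectation (\<lambda>\<sigma>. ln (?r (\<sigma> v))) = ?H" if v: "v \<in> J" for v
    proof -
      have vV: "v \<in> V" using v J by auto
      have vS: "v \<in> S" using v J by auto
      have m: "(\<lambda>\<sigma>. \<sigma> v) \<in> ?L \<rightarrow>\<^sub>M measure_pmf \<nu>"
        using measurable_component_singleton[OF vV, of ?M] vS by (simp add: L)
      have "distr ?L (measure_pmf \<nu>) (\<lambda>\<sigma>. \<sigma> v) = measure_pmf \<nu>"
        using P.PiM_component[OF vV] vS by (simp add: L)
      then have "L.expectation (\<lambda>\<sigma>. ln (?r (\<sigma> v))) = (\<integral>x. ln (?r x) \<partial>measure_pmf \<nu>)"
        using integral_distr[OF m, of "\<lambda>x. ln (?r x)"] by simp
      also have "(\<integral>x. ln (?r x) \<partial>measure_pmf \<nu>) = ?H"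
        by (subst integral_measure_pmf_real[of UNIV])
          (auto simp: relative_entropy_def likelihood_ratio_def mult.commute)
      finally show ?thesis .
    qed
    interpret Hoeffding_ineq ?L J "\<lambda>v \<sigma>. ln (?r (\<sigma> v))" "\<lambda>_. - B" "\<lambda>_. B" "card J * ?H"
    proof unfold_locales
      show "finite J" by fact
      show "L.indep_vars (\<lambda>_. borel) (\<lambda>v \<sigma>. ln (?r (\<sigma> v))) J"
        unfolding L by (rule P.indep_vars_coordinates) (use J in auto)
      show "AE \<sigma> in ?L. ln (?r (\<sigma> v)) \<in> {- B..B}" for v
      proof (intro AE_I2)
        fix \<sigma>
        show "ln (?r (\<sigma> v)) \<in> {- B..B}"
          using B[of "\<sigma> v"] unfolding atLeastAtMost_iff by linarith
      qed
      have "real (card J) * ?H = (\<Sum>v\<in>J. L.expectation (\<lambda>\<sigma>. ln (?r (\<sigma> v))))"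
        using sum.cong[OF refl mean, of J] by simp
      then show "real (card J) * ?H \<equiv> (\<Sum>v\<in>J. L.expectation (\<lambda>\<sigma>. ln (?r (\<sigma> v))))"
        by (rule eq_reflection)
    qed
    have cJ: "card J > 0" using J False by (simp add: card_gt_0_iff)
    have "measure ?L ?D \<le> measure ?L {\<sigma> \<in> space ?L. card J * \<epsilon> \<le> \<bar>(\<Sum>v\<in>J. ln (?r (\<sigma> v))) - card J * ?H\<bar>}"
    proof (rule L.finite_measure_mono)
      show "?D \<subseteq> {\<sigma> \<in> space ?L. card J * \<epsilon> \<le> \<bar>(\<Sum>v\<in>J. ln (?r (\<sigma> v))) - card J * ?H\<bar>}"
      proof
        fix \<sigma> assume \<sigma>: "\<sigma> \<in> ?D"
        have "(\<Prod>v\<in>J. ?r (\<sigma> v)) = exp (\<Sum>v\<in>J. ln (?r (\<sigma> v)))"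
          using J r by (simp add: exp_sum)
        with \<sigma> have "(\<Sum>v\<in>J. ln (?r (\<sigma> v))) < card J * (?H - \<epsilon>) \<or> card J * (?H + \<epsilon>) < (\<Sum>v\<in>J. ln (?r (\<sigma> v)))"
          by (simp add: atypical_labels_def)
        then have "card J * \<epsilon> \<le> \<bar>(\<Sum>v\<in>J. ln (?r (\<sigma> v))) - card J * ?H\<bar>"
          unfolding right_diff_distrib distrib_left by linarith
        with \<sigma> show "\<sigma> \<in> {\<sigma> \<in> space ?L. card J * \<epsilon> \<le> \<bar>(\<Sum>v\<in>J. ln (?r (\<sigma> v))) - card J * ?H\<bar>}"
          by (simp add: atypical_labels_def)
      qed
    qed measurable
    also have "\<dots> \<le> 2 * exp (- 2 * (card J * \<epsilon>)\<^sup>2 / (\<Sum>v\<in>J. (B - - B)\<^sup>2))"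
      using \<epsilon> cJ B0 by (intro Hoeffding_ineq_abs_ge) auto
    also have "- 2 * (card J * \<epsilon>)\<^sup>2 / (\<Sum>v\<in>J. (B - - B)\<^sup>2) = - c * card J"
      using cJ B0 by (simp add: c_def field_simps power2_eq_square)
    finally show ?thesis .
  qed
  show ?thesis using c0 bound by auto
qed

lemma nn_integral_planted_likelihood:
  fixes \<mu> \<nu> :: "'o::finite pmf"
  assumes J: "finite J" "J \<subseteq> V" "J \<inter> S = {}" and \<mu>: "\<And>x. pmf \<mu> x > 0"
  shows "(\<integral>\<^sup>+\<sigma>. (\<Prod>v\<in>J. ennreal (likelihood_ratio \<nu> \<mu> (\<sigma> v))) \<partial>planted V \<mu> \<nu> S) = 1"
proof -
  let ?P = "planted V \<mu> \<nu> S" and ?f = "\<lambda>\<sigma>. \<Prod>v\<in>J. ennreal (likelihood_ratio \<nu> \<mu> (\<sigma> v))"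
  have [measurable]: "?f \<in> borel_measurable ?P"
    unfolding measurable_cong_sets[OF sets_planted refl]
    using J by (intro borel_measurable_prod_ennreal measurable_label) auto
  have "(\<integral>\<^sup>+\<sigma>. ?f \<sigma> \<partial>?P) = (\<integral>\<^sup>+\<sigma>. ?f \<sigma> * indicator (space ?P) \<sigma> \<partial>?P)"
    by (intro nn_integral_cong) auto
  also have "\<dots> = emeasure (density ?P ?f) (space ?P)"
    by (rule emeasure_density[OF _ sets.top, symmetric]) measurable
  also have "density ?P ?f = planted V \<mu> \<nu> (S \<union> J)"
    by (rule planted_Un_eq_density[OF J \<mu>, symmetric])
  also have "emeasure \<dots> (space ?P) = 1"
    using prob_space.emeasure_space_1[OF prob_space_planted, of V \<mu> \<nu> "S \<union> J"] by simp
  finally show ?thesis .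
qed

lemma planted_likelihood_markov:
  fixes \<mu> \<nu> :: "'o::finite pmf"
  assumes J: "finite J" "J \<subseteq> V" and \<mu>: "\<And>x. pmf \<mu> x > 0" and a: "a > 0"
  shows "measure (planted V \<mu> \<nu> {}) {\<sigma> \<in> \<Pi>\<^sub>E v\<in>V. UNIV. a \<le> (\<Prod>v\<in>J. likelihood_ratio \<nu> \<mu> (\<sigma> v))} \<le> 1 / a"
    (is "measure ?P ?E \<le> _")
proof -
  let ?f = "\<lambda>\<sigma>. \<Prod>v\<in>J. ennreal (likelihood_ratio \<nu> \<mu> (\<sigma> v))"
  interpret P: prob_space ?P by (rule prob_space_planted)
  have [measurable]: "(\<lambda>\<sigma>. likelihood_ratio \<nu> \<mu> (\<sigma> v)) \<in> borel_measurable ?P" if "v \<in> J" for v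
    unfolding measurable_cong_sets[OF sets_planted refl] using that J by (intro measurable_label) auto
  have f: "?f \<sigma> = ennreal (\<Prod>v\<in>J. likelihood_ratio \<nu> \<mu> (\<sigma> v))" for \<sigma>
    by (intro prod_ennreal) (simp add: likelihood_ratio_def)
  have E [measurable]: "?E \<in> sets ?P"
  proof -
    have "?E = {\<sigma> \<in> space ?P. a \<le> (\<Prod>v\<in>J. likelihood_ratio \<nu> \<mu> (\<sigma> v))}" by simp
    also have "\<dots> \<in> sets ?P" by measurable
    finally show ?thesis .
  qed
  have "ennreal a * emeasure ?P ?E = (\<integral>\<^sup>+\<sigma>. ennreal a * indicator ?E \<sigma> \<partial>?P)"
    by (simp add: nn_integral_cmult_indicator)
  also have "\<dots> \<le> (\<integral>\<^sup>+\<sigma>. ?f \<sigma> \<partial>?P)"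
    by (intro nn_integral_mono) (auto simp: f indicator_def intro!: ennreal_leI)
  also have "\<dots> = 1"
    by (rule nn_integral_planted_likelihood) (use J \<mu> in auto)
  finally have "a * measure ?P ?E \<le> 1"
    using a by (simp add: P.emeasure_eq_measure flip: ennreal_mult' ennreal_1)
  with a show ?thesis by (simp add: field_simps)
qed

section \<open>Singularity below the entropy threshold\<close>

lemma space_prob_algebra_boundaryD:
  assumes "\<Psi> \<in> space (prob_algebra (boundary T))"
  shows "prob_space \<Psi>" "sets \<Psi> = sets (boundary T)" "space \<Psi> = rays T"
proof -
  show *: "prob_space \<Psi>" "sets \<Psi> = sets (boundary T)"
    using assms by (auto simp: space_prob_algebra)
  show "space \<Psi> = rays T"
    using sets_eq_imp_space_eq[OF *(2)] by (simp add: space_boundary)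
qed

lemma (in prob_space) card_disjoint_heavy_sets:
  fixes e :: real
  assumes "disjoint_family_on S A" and "\<And>v. v \<in> A \<Longrightarrow> S v \<in> events"
    and e: "e > 0" and heavy: "\<And>v. v \<in> A \<Longrightarrow> e \<le> prob (S v)"
  shows "finite A" and "card A * e \<le> 1"
proof -
  have *: "card F * e \<le> 1" if F: "finite F" "F \<subseteq> A" for F
  proof -
    have "card F * e = (\<Sum>v\<in>F. e)" by simp
    also have "\<dots> \<le> (\<Sum>v\<in>F. prob (S v))"
      using F heavy by (intro sum_mono) auto
    also have "\<dots> = prob (\<Union>v\<in>F. S v)"
      using F assms by (intro finite_measure_finite_Union[symmetric])
        (auto intro: disjoint_family_on_mono)
    finally show ?thesis
      using prob_le_1 order_trans by blast
  qed
  show "finite A"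
  proof (rule ccontr)
    assume "infinite A"
    obtain n :: nat where n: "n * e > 1"
      using reals_Archimedean3[OF e] by blast
    obtain F where F: "finite F" "card F = n" "F \<subseteq> A"
      using infinite_arbitrarily_large[OF \<open>infinite A\<close>] by blast
    with *[of F] n show False by simp
  qed
  then show "card A * e \<le> 1" by (rule *) simp
qed

definition heavy_vertices :: "'a rooted_graph \<Rightarrow> real \<Rightarrow> (nat \<Rightarrow> 'a) measure \<Rightarrow> nat \<Rightarrow> 'a set" where
  "heavy_vertices T \<beta> \<Psi> n = {X n | X. X \<in> rays T \<and> 1 < \<beta> ^ n * measure \<Psi> (rays_through T (X n))}"

lemma card_heavy_vertices:
  fixes \<beta> :: real
  assumes T: "rooted_tree T" and \<Psi>: "\<Psi> \<in> space (prob_algebra (boundary T))" and \<beta>: "\<beta> > 0"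
  shows "finite (heavy_vertices T \<beta> \<Psi> n)" and "card (heavy_vertices T \<beta> \<Psi> n) \<le> \<beta> ^ n"
proof -
  interpret prob_space \<Psi> by (rule space_prob_algebra_boundaryD[OF \<Psi>])
  let ?A = "heavy_vertices T \<beta> \<Psi> n"
  have dis: "disjoint_family_on (rays_through T) ?A"
    unfolding disjoint_family_on_def
  proof (intro ballI impI)
    fix v w assume vw: "v \<in> ?A" "w \<in> ?A" "v \<noteq> w"
    then obtain X Y where XY: "X \<in> rays T" "Y \<in> rays T" "v = X n" "w = Y n"
      by (auto simp: heavy_vertices_def)
    have "Z n = v" "Z n = w" if "Z \<in> rays_through T v \<inter> rays_through T w" for Z
      using that rays_through_iff[OF T XY(1), of Z n] rays_through_iff[OF T XY(2), of Z n] XY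
      by (auto simp: rays_through_def)
    with vw show "rays_through T v \<inter> rays_through T w = {}"
      by blast
  qed
  have meas: "rays_through T v \<in> events" if "v \<in> ?A" for v
    using that ray_in_verts[OF T] space_prob_algebra_boundaryD(2)[OF \<Psi>]
    by (auto simp: heavy_vertices_def intro!: rays_through_in_sets)
  have heavy: "1 / \<beta> ^ n \<le> prob (rays_through T v)" if "v \<in> ?A" for v
    using that \<beta> by (auto simp: heavy_vertices_def field_simps)
  have "1 / \<beta> ^ n > 0" using \<beta> by simp
  note * = card_disjoint_heavy_sets[OF dis meas this heavy]
  from *(1) show "finite ?A" .
  from *(2) show "card ?A \<le> \<beta> ^ n" using \<beta> by (simp add: field_simps)
qed

text \<open>
  If the rays that meet only finitely many heavy vertices had positive mass, then so would, for some
  level \<open>m\<close>, those that meet none from level \<open>m\<close> on. Conditioning \<open>\<Psi>\<close> on the latter gives a measure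
  that witnesses \<open>br(T) \<ge> \<beta>\<close>.
\<close>

lemma AE_infinitely_many_heavy_vertices:
  fixes \<beta> :: real
  assumes T: "rooted_tree T" and \<Psi>: "\<Psi> \<in> space (prob_algebra (boundary T))" and \<beta>: "\<beta> > 0"
    and br: "branching_number T < ereal \<beta>"
  shows "AE X in \<Psi>. \<exists>\<^sub>\<infinity>n. X n \<in> heavy_vertices T \<beta> \<Psi> n"
proof -
  note \<Psi>D = space_prob_algebra_boundaryD[OF \<Psi>]
  interpret prob_space \<Psi> by (rule \<Psi>D)
  let ?Y = "rays_through T"
  define B where "B m = {X \<in> rays T. \<forall>n\<ge>m. X n \<notin> heavy_vertices T \<beta> \<Psi> n}" for m
  have meas: "{X \<in> rays T. X n \<in> heavy_vertices T \<beta> \<Psi> n} \<in> events" for n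
  proof -
    have "{X \<in> rays T. X n \<in> heavy_vertices T \<beta> \<Psi> n} = (\<Union>v\<in>heavy_vertices T \<beta> \<Psi> n. ?Y v)"
    proof (intro set_eqI iffI)
      fix X assume "X \<in> {X \<in> rays T. X n \<in> heavy_vertices T \<beta> \<Psi> n}"
      then show "X \<in> (\<Union>v\<in>heavy_vertices T \<beta> \<Psi> n. ?Y v)"
        by (auto simp: rays_through_def)
    next
      fix X assume "X \<in> (\<Union>v\<in>heavy_vertices T \<beta> \<Psi> n. ?Y v)"
      then obtain Y where Y: "Y \<in> rays T" "Y n \<in> heavy_vertices T \<beta> \<Psi> n" "X \<in> ?Y (Y n)"
        by (auto simp: heavy_vertices_def)
      moreover have "X \<in> rays T" using Y(3) by (simp add: rays_through_def)
      ultimately show "X \<in> {X \<in> rays T. X n \<in> heavy_vertices T \<beta> \<Psi> n}"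
        using rays_through_iff[OF T Y(1), of X n] by simp
    qed
    moreover have "?Y v \<in> events" if "v \<in> heavy_vertices T \<beta> \<Psi> n" for v
      using that ray_in_verts[OF T] \<Psi>D(2) by (auto simp: heavy_vertices_def intro!: rays_through_in_sets)
    ultimately show ?thesis
      using card_heavy_vertices(1)[OF T \<Psi> \<beta>, of n] by (auto intro!: sets.finite_UN)
  qed
  have [measurable]: "B m \<in> events" for m
  proof -
    have "B m = (\<Inter>n\<in>{m..}. space \<Psi> - {X \<in> rays T. X n \<in> heavy_vertices T \<beta> \<Psi> n})"
      by (auto simp: B_def \<Psi>D(3))
    then show ?thesis
      using meas by (auto intro!: sets.countable_INT')
  qed
  have "prob (B m) = 0" for m
  proof (rule ccontr)
    assume "prob (B m) \<noteq> 0"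
    then have pos: "prob (B m) > 0"
      using measure_nonneg[of \<Psi> "B m"] by linarith
    define \<Psi>' where "\<Psi>' = uniform_measure \<Psi> (B m)"
    have "prob_space \<Psi>'"
      unfolding \<Psi>'_def using pos by (intro prob_space_uniform_measure) (auto simp: emeasure_eq_measure)
    then interpret \<Psi>': prob_space \<Psi>' .
    have \<Psi>': "\<Psi>' \<in> space (prob_algebra (boundary T))"
      using \<open>prob_space \<Psi>'\<close> \<Psi>D(2) by (simp add: space_prob_algebra \<Psi>'_def)
    define K where "K = 1 / prob (B m) + (max 1 \<beta>) ^ m"
    have "\<beta> ^ depth T v * measure \<Psi>' (?Y v) \<le> K" if v: "v \<in> verts T" for v
    proof (cases "?Y v \<inter> B m = {}")
      case True
      have "measure \<Psi>' (?Y v) = prob (B m \<inter> ?Y v) / prob (B m)"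
        using pos v \<Psi>D(2) unfolding \<Psi>'_def
        by (intro measure_uniform_measure) (auto simp: emeasure_eq_measure intro!: rays_through_in_sets)
      also have "B m \<inter> ?Y v = {}" using True by blast
      finally show ?thesis using pos by (simp add: K_def)
    next
      case False
      then obtain X n where X: "X \<in> rays T" "X \<in> B m" "v = X n"
        by (auto simp: rays_through_def)
      have d: "depth T v = n" using depth_ray[OF T X(1)] X(3) by simp
      have Yv: "?Y v \<in> events" using v \<Psi>D(2) by (simp add: rays_through_in_sets)
      show ?thesis
      proof (cases "n \<ge> m")
        case True
        then have "\<beta> ^ n * prob (?Y v) \<le> 1"
          using X by (auto simp: B_def heavy_vertices_def not_less)
        moreover have "measure \<Psi>' (?Y v) = prob (B m \<inter> ?Y v) / prob (B m)"
          using pos Yv unfolding \<Psi>'_def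
          by (intro measure_uniform_measure) (auto simp: emeasure_eq_measure)
        moreover have "\<beta> ^ n * prob (B m \<inter> ?Y v) \<le> \<beta> ^ n * prob (?Y v)"
          using Yv \<beta> by (intro mult_left_mono finite_measure_mono) auto
        ultimately have "\<beta> ^ n * measure \<Psi>' (?Y v) \<le> 1 / prob (B m)"
          using pos by (simp add: divide_le_cancel)
        then show ?thesis by (simp add: d K_def add_increasing2)
      next
        case False
        have "\<beta> ^ n * measure \<Psi>' (?Y v) \<le> \<beta> ^ n"
          using \<beta> \<Psi>'.prob_le_1[of "?Y v"] by (intro mult_left_le) auto
        also have "\<dots> \<le> max 1 \<beta> ^ n" using \<beta> by (intro power_mono) auto
        also have "\<dots> \<le> max 1 \<beta> ^ m" using False by (intro power_increasing) auto
        finally show ?thesis using pos by (simp add: d K_def add_increasing)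
      qed
    qed
    then have "bdd_above ((\<lambda>v. \<beta> ^ depth T v * measure \<Psi>' (?Y v)) ` verts T)"
      by (rule bdd_aboveI2)
    then have "ereal \<beta> \<le> branching_number T"
      unfolding branching_number_def using \<beta> \<Psi>' by (intro Sup_upper) blast
    with br show False by simp
  qed
  then have "AE X in \<Psi>. X \<notin> B m" for m
    by (intro AE_not_in) (auto simp: null_sets_def emeasure_eq_measure)
  then have "AE X in \<Psi>. \<forall>m. X \<notin> B m"
    by (simp add: AE_all_countable)
  then show ?thesis
    by (rule AE_mp) (auto simp: B_def \<Psi>D(3) INFM_nat_le intro!: AE_I2)
qed

text \<open>
  The separating event asks for infinitely many levels with a heavy vertex whose ancestors carry an
  exponentially large likelihood.
\<close>

lemma mutually_singular_hidden_ray_law: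
  fixes T :: "'a rooted_graph" and \<mu> \<nu> :: "'o::finite pmf"
  assumes T: "rooted_tree T"
    and \<mu>: "\<And>x. pmf \<mu> x > 0" and \<nu>: "\<And>x. pmf \<nu> x > 0"
    and \<Psi>: "\<Psi> \<in> space (prob_algebra (boundary T))"
    and \<beta>: "\<beta> > 0" "branching_number T < ereal \<beta>" "\<beta> < exp (relative_entropy \<nu> \<mu>)"
  shows "mutually_singular (background_law T \<mu>) (hidden_ray_law T \<mu> \<nu> \<Psi>)"
proof -
  note \<Psi>D = space_prob_algebra_boundaryD[OF \<Psi>]
  let ?r = "likelihood_ratio \<nu> \<mu>" and ?H = "relative_entropy \<nu> \<mu>"
  let ?V = "verts T" and ?D = "heavy_vertices T \<beta> \<Psi>"
  let ?P = "planted ?V \<mu> \<nu> {}" and ?L = "\<lambda>X. planted ?V \<mu> \<nu> (range X)"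
  \<comment> \<open>Half of the gap is spent on the fluctuations of the likelihood, half on the union bound.\<close>
  define \<epsilon> where "\<epsilon> = (?H - ln \<beta>) / 2"
  have \<epsilon>: "\<epsilon> > 0"
    using \<beta> ln_less_cancel_iff[of \<beta> "exp ?H"] by (simp add: \<epsilon>_def)
  have "?H - 2 * \<epsilon> = ln \<beta>" by (simp add: \<epsilon>_def field_simps)
  then have \<beta>\<epsilon>: "\<beta> = exp (?H - 2 * \<epsilon>)" using \<beta>(1) by simp
  obtain c :: real where c: "c > 0" and conc: "\<And>V S (J :: 'a set). finite J \<Longrightarrow> J \<subseteq> S \<Longrightarrow> J \<subseteq> V \<Longrightarrow>
    measure (planted V \<mu> \<nu> S) (atypical_labels V \<mu> \<nu> \<epsilon> J) \<le> 2 * exp (- c * card J)"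
    using planted_likelihood_concentration[OF \<mu> \<nu> \<epsilon>] by metis
  define E where "E X n = {\<sigma> \<in> \<Pi>\<^sub>E v\<in>?V. UNIV. exp (n * (?H - \<epsilon>)) \<le> (\<Prod>v\<in>X ` {..<n}. ?r (\<sigma> v))}"
    for X and n :: nat
  have Es: "E X n \<in> sets (Pi\<^sub>M ?V (\<lambda>_. count_space UNIV))" if "X \<in> rays T" for X n
  proof -
    have "(\<lambda>\<sigma>. \<Prod>v\<in>X ` {..<n}. ?r (\<sigma> v)) \<in> borel_measurable (Pi\<^sub>M ?V (\<lambda>_. count_space UNIV))"
      using ray_in_verts[OF T that] by (intro borel_measurable_prod measurable_label) auto
    then have "{\<sigma> \<in> space (Pi\<^sub>M ?V (\<lambda>_. count_space UNIV)). exp (n * (?H - \<epsilon>)) \<le> (\<Prod>v\<in>X ` {..<n}. ?r (\<sigma> v))}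
        \<in> sets (Pi\<^sub>M ?V (\<lambda>_. count_space UNIV))"
      by measurable
    then show ?thesis by (simp add: E_def space_PiM)
  qed
  \<comment> \<open>All rays through \<open>v\<close> agree up to \<open>v\<close>, so any of them names the ancestors of \<open>v\<close>.\<close>
  define \<rho> where "\<rho> n v = (SOME X. X \<in> rays T \<and> X n = v)" for n v
  have \<rho>: "\<rho> n v \<in> rays T" "\<rho> n v n = v" if "v \<in> ?D n" for n v
  proof -
    have "\<exists>X. X \<in> rays T \<and> X n = v" using that by (auto simp: heavy_vertices_def)
    from someI_ex[OF this] show "\<rho> n v \<in> rays T" "\<rho> n v n = v"
      unfolding \<rho>_def by auto
  qed
  define A where "A n = (\<Union>v\<in>?D n. E (\<rho> n v) n)" for n
  have As: "A n \<in> sets (Pi\<^sub>M ?V (\<lambda>_. count_space UNIV))" for n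
    unfolding A_def using card_heavy_vertices(1)[OF T \<Psi> \<beta>(1)] Es \<rho>(1) by (intro sets.finite_UN) auto
  note sets_P = sets_planted[of ?V \<mu> \<nu>]
  interpret P: prob_space ?P by (rule prob_space_planted)
  have card_seg: "card (X ` {..<n}) = n" if "X \<in> rays T" for X n
    using that by (subst card_image) (auto simp: rays_def intro: inj_on_subset)
  have PA: "P.prob (A n) \<le> exp (- \<epsilon>) ^ n" for n
  proof -
    have "P.prob (A n) \<le> (\<Sum>v\<in>?D n. P.prob (E (\<rho> n v) n))"
      unfolding A_def using card_heavy_vertices(1)[OF T \<Psi> \<beta>(1)] Es \<rho>(1) sets_P
      by (intro measure_UNION_le) auto
    also have "\<dots> \<le> (\<Sum>v\<in>?D n. 1 / exp (n * (?H - \<epsilon>)))"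
      unfolding E_def using ray_in_verts[OF T \<rho>(1)] \<mu>
      by (intro sum_mono planted_likelihood_markov) auto
    also have "\<dots> = card (?D n) / exp (n * (?H - \<epsilon>))" by simp
    also have "\<dots> \<le> \<beta> ^ n / exp (n * (?H - \<epsilon>))"
      using card_heavy_vertices(2)[OF T \<Psi> \<beta>(1)] by (intro divide_right_mono) auto
    also have "\<dots> = exp (- \<epsilon>) ^ n"
      unfolding \<beta>\<epsilon> by (simp add: exp_of_nat_mult[symmetric] exp_diff[symmetric] algebra_simps)
    finally show ?thesis .
  qed
  define N where "N = {\<sigma> \<in> space ?P. \<exists>\<^sub>\<infinity>n. \<sigma> \<in> A n}"
  have N: "N \<in> sets ?P"
    unfolding N_def INFM_nat_le using As sets_P by measurable
  have "AE \<sigma> in ?P. eventually (\<lambda>n. \<sigma> \<in> space ?P - A n) sequentially"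
  proof (rule borel_cantelli_AE1)
    show "summable (\<lambda>n. P.prob (A n))"
      by (rule summable_comparison_test'[of "\<lambda>n. exp (- \<epsilon>) ^ n" 0])
        (use PA \<epsilon> in \<open>auto intro!: summable_geometric\<close>)
  qed (use As sets_P in \<open>auto simp: P.emeasure_eq_measure\<close>)
  then have "AE \<sigma> in ?P. \<sigma> \<notin> N"
    by (rule AE_mp) (auto simp: N_def not_INFM MOST_nat_le eventually_sequentially intro!: AE_I2)
  then have "emeasure ?P N = 0"
    using N AE_iff_measurable[of N ?P "\<lambda>\<sigma>. \<sigma> \<notin> N"] sets.sets_into_space[OF N] by auto
  moreover have "emeasure (hidden_ray_law T \<mu> \<nu> \<Psi>) (space ?P - N) = 0"
  proof -
    have "AE X in \<Psi>. emeasure (?L X) (space ?P - N) = 0"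
      using AE_infinitely_many_heavy_vertices[OF T \<Psi> \<beta>(1,2)]
    proof (rule AE_mp, intro AE_I2 impI)
      fix X assume X: "X \<in> space \<Psi>" and heavy: "\<exists>\<^sub>\<infinity>n. X n \<in> ?D n"
      have X: "X \<in> rays T" using X \<Psi>D(3) by simp
      interpret L: prob_space "?L X" by (rule prob_space_planted)
      have "AE \<sigma> in ?L X. eventually (\<lambda>n. \<sigma> \<in> space (?L X) - (space (?L X) - E X n)) sequentially"
      proof (rule borel_cantelli_AE1)
        have bd: "L.prob (space (?L X) - E X n) \<le> 2 * exp (- c) ^ n" for n
        proof -
          let ?J = "X ` {..<n}"
          have "L.prob (space (?L X) - E X n) \<le> L.prob (atypical_labels ?V \<mu> \<nu> \<epsilon> ?J)"
            using atypical_labels_sets[of ?J ?V \<mu> \<nu> \<epsilon>] ray_in_verts[OF T X] sets_P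
            by (intro L.finite_measure_mono) (auto simp: E_def atypical_labels_def card_seg[OF X] not_le)
          also have "\<dots> \<le> 2 * exp (- c * card ?J)"
            using ray_in_verts[OF T X] by (intro conc) auto
          also have "\<dots> = 2 * exp (- c) ^ n"
            by (simp add: card_seg[OF X] exp_of_nat_mult[symmetric] mult.commute)
          finally show ?thesis .
        qed
        show "summable (\<lambda>n. L.prob (space (?L X) - E X n))"
          by (rule summable_comparison_test'[of "\<lambda>n. 2 * exp (- c) ^ n" 0])
            (use bd c in \<open>auto intro!: summable_mult summable_geometric\<close>)
        show "space (?L X) - E X n \<in> L.events" for n
          by (rule sets.compl_sets) (simp add: Es[OF X] sets_P)
      qed (simp add: L.emeasure_eq_measure)
      then have "AE \<sigma> in ?L X. \<sigma> \<in> N"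
      proof (rule AE_mp, intro AE_I2 impI)
        fix \<sigma> assume \<sigma>: "\<sigma> \<in> space (?L X)"
          and "\<forall>\<^sub>F n in sequentially. \<sigma> \<in> space (?L X) - (space (?L X) - E X n)"
        then have "\<forall>\<^sub>\<infinity>n. \<sigma> \<in> E X n"
          by (auto simp: cofinite_eq_sequentially elim!: eventually_mono)
        with heavy have "\<exists>\<^sub>\<infinity>n. X n \<in> ?D n \<and> \<sigma> \<in> E X n"
          by (rule INFM_conjI)
        then have "\<exists>\<^sub>\<infinity>n. \<sigma> \<in> A n"
        proof (rule INFM_mono)
          fix n assume n: "X n \<in> ?D n \<and> \<sigma> \<in> E X n"
          let ?Y = "\<rho> n (X n)"
          have "?Y k = X k" if "k \<le> n" for k
            using rays_meet(2)[OF T \<rho>(1) X \<rho>(2) that] n by simp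
          then have "?Y ` {..<n} = X ` {..<n}" by (intro image_cong) auto
          then have "E ?Y n = E X n" by (simp add: E_def)
          with n show "\<sigma> \<in> A n" by (auto simp: A_def)
        qed
        with \<sigma> show "\<sigma> \<in> N" by (simp add: N_def)
      qed
      then show "emeasure (?L X) (space ?P - N) = 0"
        using N sets_P sets.compl_sets[OF N]
        by (subst (asm) AE_iff_measurable[of "space ?P - N"]) auto
    qed
    then have "(\<integral>\<^sup>+X. emeasure (?L X) (space ?P - N) \<partial>\<Psi>) = 0"
      by (simp add: nn_integral_cong_AE[where v="\<lambda>_. 0"])
    moreover have "space ?P - N \<in> sets (background_law T \<mu>)"
      unfolding background_law_eq_planted[of T \<mu> \<nu>] using N by (rule sets.compl_sets)
    ultimately show ?thesis
      by (simp add: emeasure_hidden_ray_law[OF \<Psi>] labels_given_ray_eq_planted)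
  qed
  ultimately show ?thesis
    unfolding mutually_singular_def background_law_eq_planted[of T \<mu> \<nu>] using N by blast
qed

section \<open>Absolute continuity of the planted law above the entropy threshold\<close>

lemma planted_path_eventually_typical:
  fixes \<mu> \<nu> :: "'o::finite pmf" and V :: "'a set"
  assumes \<mu>: "\<And>x. pmf \<mu> x > 0" and \<nu>: "\<And>x. pmf \<nu> x > 0" and \<epsilon>: "\<epsilon> > 0" and \<delta>: "(\<delta>::real) > 0"
  shows "\<exists>m. \<forall>X :: nat \<Rightarrow> 'a. inj X \<longrightarrow> range X \<subseteq> V \<longrightarrow>
    emeasure (planted V \<mu> \<nu> (range X)) (\<Union>k. atypical_labels V \<mu> \<nu> \<epsilon> (X ` {..<k + m})) \<le> ennreal \<delta>"
proof -
  obtain c :: real where c: "c > 0" and conc: "\<And>V S (J :: 'a set). finite J \<Longrightarrow> J \<subseteq> S \<Longrightarrow> J \<subseteq> V \<Longrightarrow>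
    measure (planted V \<mu> \<nu> S) (atypical_labels V \<mu> \<nu> \<epsilon> J) \<le> 2 * exp (- c * card J)"
    using planted_likelihood_concentration[OF \<mu> \<nu> \<epsilon>] by metis
  define q where "q = exp (- c)"
  have q: "0 < q" "q < 1" using c by (auto simp: q_def)
  have "(\<lambda>m. 2 / (1 - q) * q ^ m) \<longlonglongrightarrow> 2 / (1 - q) * 0"
    using q by (intro tendsto_mult tendsto_const LIMSEQ_power_zero) auto
  then have "\<forall>\<^sub>F m in sequentially. 2 / (1 - q) * q ^ m < \<delta>"
    using \<delta> by (intro order_tendstoD) auto
  then obtain m where m: "2 / (1 - q) * q ^ m < \<delta>"
    by (auto simp: eventually_sequentially)
  show ?thesis
  proof (intro exI[of _ m] allI impI)
    fix X :: "nat \<Rightarrow> 'a" assume X: "inj X" "range X \<subseteq> V"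
    let ?L = "planted V \<mu> \<nu> (range X)" and ?D = "\<lambda>k. atypical_labels V \<mu> \<nu> \<epsilon> (X ` {..<k + m})"
    interpret L: prob_space ?L by (rule prob_space_planted)
    have D: "?D k \<in> L.events" for k
      unfolding sets_planted using X by (intro atypical_labels_sets) auto
    have "emeasure ?L (\<Union>k. ?D k) \<le> (\<Sum>k. emeasure ?L (?D k))"
      using D by (intro emeasure_subadditive_countably) auto
    also have "\<dots> \<le> (\<Sum>k. ennreal (2 * q ^ m * q ^ k))"
    proof (intro suminf_le summableI)
      fix k
      have "card (X ` {..<k + m}) = k + m"
        using X by (subst card_image) (auto intro: inj_on_subset)
      then have "L.prob (?D k) \<le> 2 * exp (- c * (k + m))"
        using conc[of "X ` {..<k + m}" "range X" V] X by auto
      also have "exp (- c * (k + m)) = q ^ m * q ^ k"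
        unfolding q_def by (simp add: exp_of_nat_mult[symmetric] exp_add[symmetric] algebra_simps)
      finally show "emeasure ?L (?D k) \<le> ennreal (2 * q ^ m * q ^ k)"
        by (simp add: L.emeasure_eq_measure ennreal_leI mult.assoc)
    qed
    also have "\<dots> = ennreal (2 * q ^ m * (1 / (1 - q)))"
      using q geometric_sums[of q] by (intro suminf_ennreal_eq sums_mult) auto
    also have "\<dots> \<le> ennreal \<delta>"
      using m by (intro ennreal_leI) (simp add: field_simps)
    finally show "emeasure ?L (\<Union>k. ?D k) \<le> ennreal \<delta>" .
  qed
qed

text \<open>
  Labels planted along \<open>X\<close> inflate the likelihood of \<open>Y\<close> only on the common initial segment, where
  typicality controls it; the remaining factors belong to unplanted vertices and integrate to one.
  The term of the last common vertex in \<open>J\<close> alone carries the bound; the whole series is written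
  because its integral over \<open>Y\<close> is explicit.
\<close>

lemma nn_integral_typical_likelihood_le:
  fixes \<mu> \<nu> :: "'o::finite pmf"
  assumes T: "rooted_tree T" and X: "X \<in> rays T" and Y: "Y \<in> rays T"
    and J: "finite J" "J \<subseteq> verts T" "ray_closed T J" and \<mu>: "\<And>x. pmf \<mu> x > 0"
    and b: "b \<ge> 0" and K: "K \<ge> 0"
    and typical: "\<And>\<sigma> k. \<sigma> \<in> G \<Longrightarrow> (\<Prod>v\<in>X ` {..<k}. likelihood_ratio \<nu> \<mu> (\<sigma> v)) \<le> K * b ^ k"
  shows "(\<integral>\<^sup>+\<sigma>. (\<Prod>v\<in>J \<inter> range Y. ennreal (likelihood_ratio \<nu> \<mu> (\<sigma> v))) * indicator G \<sigma>
            \<partial>planted (verts T) \<mu> \<nu> (range X))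
    \<le> ennreal K * (1 + ennreal b * (\<Sum>k. ennreal (b ^ k) * indicator (rays_through T (X k)) Y))"
    (is "?I \<le> ennreal K * (1 + ennreal b * ?s)")
proof -
  let ?L = "planted (verts T) \<mu> \<nu> (range X)" and ?r = "likelihood_ratio \<nu> \<mu>"
  obtain m where m: "J \<inter> range X \<inter> range Y = X ` {..<m}"
    using ray_closed_segment[OF T X Y J(1,3)] .
  define J1 where "J1 = J \<inter> range Y - range X"
  have split: "J \<inter> range Y = J1 \<union> X ` {..<m}" "J1 \<inter> X ` {..<m} = {}"
    using m by (auto simp: J1_def)
  have J1: "finite J1" "J1 \<subseteq> verts T" "J1 \<inter> range X = {}"
    using J by (auto simp: J1_def)
  have "?I \<le> (\<integral>\<^sup>+\<sigma>. ennreal (K * b ^ m) * (\<Prod>v\<in>J1. ennreal (?r (\<sigma> v))) \<partial>?L)"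
  proof (intro nn_integral_mono)
    fix \<sigma>
    show "(\<Prod>v\<in>J \<inter> range Y. ennreal (?r (\<sigma> v))) * indicator G \<sigma> \<le>
        ennreal (K * b ^ m) * (\<Prod>v\<in>J1. ennreal (?r (\<sigma> v)))"
    proof (cases "\<sigma> \<in> G")
      case True
      have "(\<Prod>v\<in>X ` {..<m}. ennreal (?r (\<sigma> v))) = ennreal (\<Prod>v\<in>X ` {..<m}. ?r (\<sigma> v))"
        by (intro prod_ennreal) (simp add: likelihood_ratio_def)
      also have "\<dots> \<le> ennreal (K * b ^ m)"
        by (intro ennreal_leI typical True)
      finally have le: "(\<Prod>v\<in>X ` {..<m}. ennreal (?r (\<sigma> v))) \<le> ennreal (K * b ^ m)" .
      have "(\<Prod>v\<in>J \<inter> range Y. ennreal (?r (\<sigma> v))) =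
          (\<Prod>v\<in>X ` {..<m}. ennreal (?r (\<sigma> v))) * (\<Prod>v\<in>J1. ennreal (?r (\<sigma> v)))"
        unfolding split(1) using J1 split(2) by (subst prod.union_disjoint) (auto simp: mult.commute)
      with True mult_right_mono[OF le] show ?thesis
        by simp
    qed simp
  qed
  also have "\<dots> = ennreal (K * b ^ m) * (\<integral>\<^sup>+\<sigma>. (\<Prod>v\<in>J1. ennreal (?r (\<sigma> v))) \<partial>?L)"
  proof (rule nn_integral_cmult)
    show "(\<lambda>\<sigma>. \<Prod>v\<in>J1. ennreal (?r (\<sigma> v))) \<in> borel_measurable ?L"
      unfolding measurable_cong_sets[OF sets_planted refl]
      using J1 by (intro borel_measurable_prod_ennreal measurable_label) auto
  qed
  also have "\<dots> = ennreal K * ennreal (b ^ m)"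
    using nn_integral_planted_likelihood[OF J1 \<mu>] K b by (simp add: ennreal_mult)
  also have "ennreal (b ^ m) \<le> 1 + ennreal b * ?s"
  proof (cases m)
    case 0
    then show ?thesis by simp
  next
    case (Suc k)
    have "X k \<in> X ` {..<m}" using Suc by auto
    then have "X k \<in> range Y" using m by blast
    then have "Y \<in> rays_through T (X k)" using Y by (simp add: rays_through_def)
    then have "ennreal (b ^ k) = (\<Sum>i\<in>{k}. ennreal (b ^ i) * indicator (rays_through T (X i)) Y)"
      by simp
    also have "\<dots> \<le> ?s"
      by (intro sum_le_suminf) auto
    finally have "ennreal b * ennreal (b ^ k) \<le> ennreal b * ?s"
      by (intro mult_left_mono) auto
    then show ?thesis
      using b by (simp add: Suc ennreal_mult[symmetric] add_increasing)
  qed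
  finally show ?thesis
    by (simp add: mult_left_mono)
qed

lemma emeasure_hidden_ray_law_planted:
  assumes "\<Psi> \<in> space (prob_algebra (boundary T))" "A \<in> sets (Pi\<^sub>M (verts T) (\<lambda>_. count_space UNIV))"
  shows "emeasure (hidden_ray_law T \<mu> \<nu> \<Psi>) A = (\<integral>\<^sup>+X. emeasure (planted (verts T) \<mu> \<nu> (range X)) A \<partial>\<Psi>)"
  using emeasure_hidden_ray_law[of \<Psi> T A \<mu> \<nu>] assms sets_planted[of "verts T" \<mu> \<nu> "{}"]
  by (simp add: labels_given_ray_eq_planted background_law_eq_planted[of T \<mu> \<nu>])

text \<open>
  On the labels of a finite set \<open>J\<close> the hidden-ray law has the density
  \<open>M(\<sigma>) = \<integral> (\<Prod>v\<in>J \<inter> range Y. \<nu>(\<sigma> v)/\<mu>(\<sigma> v)) d\<Psi>(Y)\<close>. It suffices to see that \<open>M\<close> is rarely large under the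
  hidden-ray law itself, uniformly in \<open>J\<close>. Given the ray \<open>X\<close> and up to an event of small
  probability, the likelihood of the first \<open>k\<close> labels of \<open>X\<close> is at most \<open>K b\<^sup>k\<close> with
  \<open>exp H < b < \<beta>\<close>, while the rays sharing these vertices have mass at most a constant times
  \<open>\<beta>\<^sup>-\<^sup>k\<close>; the mean of \<open>M\<close> on that event is therefore bounded by a geometric series.
\<close>

lemma hidden_ray_law_cylinder_le:
  fixes T :: "'a rooted_graph" and \<mu> \<nu> :: "'o::finite pmf" and \<beta> :: real
  assumes T: "rooted_tree T"
    and \<mu>: "\<And>x. pmf \<mu> x > 0" and \<nu>: "\<And>x. pmf \<nu> x > 0"
    and \<Psi>: "\<Psi> \<in> space (prob_algebra (boundary T))"
    and \<beta>: "exp (relative_entropy \<nu> \<mu>) < \<beta>"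
    and C: "\<And>v. v \<in> verts T \<Longrightarrow> \<beta> ^ depth T v * measure \<Psi> (rays_through T v) \<le> C"
    and \<delta>: "(\<delta>::real) > 0"
  shows "\<exists>lam>0::real. \<forall>J A. finite J \<longrightarrow> J \<subseteq> verts T \<longrightarrow> A \<in> cylinder_sets (verts T) J \<longrightarrow>
    emeasure (hidden_ray_law T \<mu> \<nu> \<Psi>) A \<le> ennreal lam * emeasure (background_law T \<mu>) A + ennreal \<delta>"
proof -
  note \<Psi>D = space_prob_algebra_boundaryD[OF \<Psi>]
  interpret \<Psi>: prob_space \<Psi> by (rule \<Psi>D)
  let ?r = "likelihood_ratio \<nu> \<mu>" and ?H = "relative_entropy \<nu> \<mu>"
  let ?V = "verts T" and ?Q = "hidden_ray_law T \<mu> \<nu> \<Psi>"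
  let ?P = "planted ?V \<mu> \<nu> {}" and ?L = "\<lambda>X. planted ?V \<mu> \<nu> (range X)"
  let ?C = "\<lambda>_::'a. count_space UNIV :: 'o measure"
  note sets_P = sets_planted[of ?V \<mu> \<nu>]
  have \<beta>0: "\<beta> > 0" using \<beta> exp_gt_zero[of ?H] by linarith
  have r: "?r x > 0" for x
    using \<mu>[of x] \<nu>[of x] by (simp add: likelihood_ratio_def)
  have C0: "C \<ge> 0"
  proof -
    have "root T \<in> ?V" using T by (simp add: rooted_tree_def)
    from C[OF this] show ?thesis
      using \<beta>0 by (meson measure_nonneg mult_nonneg_nonneg order_trans zero_le_power less_imp_le)
  qed
  define \<epsilon> where "\<epsilon> = (ln \<beta> - ?H) / 2"
  have \<epsilon>: "\<epsilon> > 0"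
    using \<beta> \<beta>0 ln_less_cancel_iff[of "exp ?H" \<beta>] by (simp add: \<epsilon>_def)
  define b where "b = exp (?H + \<epsilon>)"
  have b: "0 < b" "b < \<beta>"
  proof -
    have "?H + \<epsilon> < ln \<beta>" using \<epsilon> by (simp add: \<epsilon>_def field_simps)
    then have "b < exp (ln \<beta>)" unfolding b_def by (rule exp_less_mono)
    then show "b < \<beta>" using \<beta>0 by simp
  qed (simp add: b_def)
  obtain m where m: "\<And>X :: nat \<Rightarrow> 'a. inj X \<Longrightarrow> range X \<subseteq> ?V \<Longrightarrow>
      emeasure (?L X) (\<Union>k. atypical_labels ?V \<mu> \<nu> \<epsilon> (X ` {..<k + m})) \<le> ennreal (\<delta> / 2)"
    using planted_path_eventually_typical[OF \<mu> \<nu> \<epsilon>, of "\<delta> / 2" ?V] \<delta> by auto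
  \<comment> \<open>The first \<open>m\<close> levels need not be typical; there the ratios are bounded by the constant \<open>R\<close>.\<close>
  define R where "R = (\<Sum>x\<in>UNIV. ?r x)"
  have R: "?r x \<le> R" for x
    unfolding R_def using r by (intro member_le_sum) (auto intro: less_imp_le)
  define K where "K = 1 + (\<Sum>k<m. (R / b) ^ k)"
  have R0: "R \<ge> 0" using r R by (meson less_imp_le order_trans)
  have K: "K \<ge> 1" unfolding K_def using R0 b by (simp add: sum_nonneg)
  \<comment> \<open>\<open>K'\<close> bounds the mean of the density on the typical event, by summing the geometric series.\<close>
  define K' where "K' = K * (1 + b * (C / (1 - b / \<beta>)))"
  have K': "K' > 0"
    unfolding K'_def using K b \<beta>0 C0 by (intro mult_pos_pos add_pos_nonneg) (auto simp: field_simps)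
  define G where "G X = (\<Pi>\<^sub>E v\<in>?V. UNIV) - (\<Union>k. atypical_labels ?V \<mu> \<nu> \<epsilon> (X ` {..<k + m}))" for X
  have typical: "(\<Prod>v\<in>X ` {..<k}. ?r (\<sigma> v)) \<le> K * b ^ k" if X: "X \<in> rays T" and \<sigma>: "\<sigma> \<in> G X" for X \<sigma> k
  proof -
    have card: "card (X ` {..<k}) = k"
      using X by (subst card_image) (auto simp: rays_def intro: inj_on_subset)
    show ?thesis
    proof (cases "k < m")
      case True
      have "(\<Prod>v\<in>X ` {..<k}. ?r (\<sigma> v)) \<le> (\<Prod>v\<in>X ` {..<k}. R)"
        using r R by (intro prod_mono) (auto intro: less_imp_le)
      also have "\<dots> = (R / b) ^ k * b ^ k"
        using b by (simp add: card power_divide)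
      also have "\<dots> \<le> K * b ^ k"
        unfolding K_def using R0 b True member_le_sum[of k "{..<m}" "\<lambda>k. (R / b) ^ k"]
        by (intro mult_right_mono) (auto simp: add_increasing)
      finally show ?thesis .
    next
      case False
      then have "\<sigma> \<notin> atypical_labels ?V \<mu> \<nu> \<epsilon> (X ` {..<k})" "\<sigma> \<in> (\<Pi>\<^sub>E v\<in>?V. UNIV)"
        using \<sigma> unfolding G_def by (auto dest: spec[of _ "k - m"])
      then have "(\<Prod>v\<in>X ` {..<k}. ?r (\<sigma> v)) \<le> exp (k * (?H + \<epsilon>))"
        by (simp add: atypical_labels_def card not_less)
      also have "\<dots> = b ^ k" by (simp add: b_def exp_of_nat_mult)
      also have "\<dots> \<le> K * b ^ k" using K b by simp
      finally show ?thesis .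
    qed
  qed
  have rays_meas: "rays_through T v \<in> \<Psi>.events" if "v \<in> ?V" for v
    using that \<Psi>D(2) by (simp add: rays_through_in_sets)
  \<comment> \<open>The level at which Markov's inequality leaves the density the probability \<open>\<delta>/2\<close>.\<close>
  define lam where "lam = 2 * K' / \<delta>"
  have lam: "lam > 0" using K' \<delta> by (simp add: lam_def)
  have main: "emeasure ?Q A \<le> ennreal lam * emeasure ?P A + ennreal \<delta>"
    if J: "finite J" "J \<subseteq> ?V" "ray_closed T J" and A: "A \<in> cylinder_sets ?V J" for J A
  proof -
    define w where "w Y \<sigma> = (\<Prod>v\<in>J. if v \<in> range Y then ennreal (?r (\<sigma> v)) else 1)"
      for Y :: "nat \<Rightarrow> 'a" and \<sigma> :: "'a \<Rightarrow> 'o"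
    have w: "w Y \<sigma> = (\<Prod>v\<in>J \<inter> range Y. ennreal (?r (\<sigma> v)))" for Y \<sigma>
      unfolding w_def using J by (simp add: prod.If_cases)
    have w_meas: "case_prod w \<in> borel_measurable (\<Psi> \<Otimes>\<^sub>M Pi\<^sub>M I ?C)" if I: "J \<subseteq> I" for I
    proof -
      have [measurable]: "(\<lambda>\<sigma>. ennreal (?r (\<sigma> v))) \<in> borel_measurable (Pi\<^sub>M I ?C)" if "v \<in> J" for v
        using that I by (intro measurable_label) auto
      have [measurable]: "Measurable.pred \<Psi> (\<lambda>Y. v \<in> range Y)" if "v \<in> J" for v
      proof -
        have "{Y \<in> space \<Psi>. v \<in> range Y} = rays_through T v"
          by (auto simp: \<Psi>D(3) rays_through_def)
        then show ?thesis
          using rays_meas[of v] that J unfolding pred_def by auto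
      qed
      have "(\<lambda>(Y, \<sigma>). \<Prod>v\<in>J. if v \<in> range Y then ennreal (?r (\<sigma> v)) else 1) \<in> borel_measurable (\<Psi> \<Otimes>\<^sub>M Pi\<^sub>M I ?C)"
        unfolding case_prod_beta
        by (intro borel_measurable_prod_ennreal) measurable
      then show ?thesis by (simp add: w_def[abs_def] case_prod_beta)
    qed
    have w_restrict: "w Y (restrict \<sigma> J) = w Y \<sigma>" for Y \<sigma>
      unfolding w_def by (intro prod.cong) auto
    define M where "M \<sigma> = (\<integral>\<^sup>+Y. w Y \<sigma> \<partial>\<Psi>)" for \<sigma>
    have M_meas: "M \<in> borel_measurable (Pi\<^sub>M I ?C)" if "J \<subseteq> I" for I
      unfolding M_def[abs_def]
      using measurable_compose[OF measurable_pair_swap' w_meas[OF that]]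
      by (intro \<Psi>.borel_measurable_nn_integral) (simp add: case_prod_beta)
    have w_meas' [measurable]: "case_prod w \<in> borel_measurable (\<Psi> \<Otimes>\<^sub>M planted ?V \<mu> \<nu> S)" for S
      using w_meas[OF J(2)] by (simp add: measurable_cong_sets[OF sets_pair_measure_cong[OF refl sets_P] refl])
    have M_meas' [measurable]: "M \<in> borel_measurable (planted ?V \<mu> \<nu> S)" for S
      using M_meas[OF J(2)] by (simp add: measurable_cong_sets[OF sets_P refl])
    have M_Fubini: "(\<integral>\<^sup>+\<sigma>. M \<sigma> * indicator D \<sigma> \<partial>planted ?V \<mu> \<nu> S) =
        (\<integral>\<^sup>+Y. (\<integral>\<^sup>+\<sigma>. w Y \<sigma> * indicator D \<sigma> \<partial>planted ?V \<mu> \<nu> S) \<partial>\<Psi>)"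
      if D [measurable]: "D \<in> sets (planted ?V \<mu> \<nu> S)" for D S
    proof -
      interpret S: prob_space "planted ?V \<mu> \<nu> S" by (rule prob_space_planted)
      interpret pair_sigma_finite \<Psi> "planted ?V \<mu> \<nu> S" ..
      have wS: "(\<lambda>Y. w Y \<sigma>) \<in> borel_measurable \<Psi>" if "\<sigma> \<in> space (planted ?V \<mu> \<nu> S)" for \<sigma>
        using measurable_compose[OF measurable_Pair2'[OF that] w_meas'] by simp
      have "(\<integral>\<^sup>+\<sigma>. M \<sigma> * indicator D \<sigma> \<partial>planted ?V \<mu> \<nu> S) =
          (\<integral>\<^sup>+\<sigma>. (\<integral>\<^sup>+Y. w Y \<sigma> * indicator D \<sigma> \<partial>\<Psi>) \<partial>planted ?V \<mu> \<nu> S)"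
        unfolding M_def using wS by (intro nn_integral_cong nn_integral_multc[symmetric]) auto
      also have "\<dots> = (\<integral>\<^sup>+Y. (\<integral>\<^sup>+\<sigma>. w Y \<sigma> * indicator D \<sigma> \<partial>planted ?V \<mu> \<nu> S) \<partial>\<Psi>)"
      proof (rule Fubini')
        have "(\<lambda>x. case_prod w x * indicator D (snd x)) \<in> borel_measurable (\<Psi> \<Otimes>\<^sub>M planted ?V \<mu> \<nu> S)"
          by measurable
        then show "(\<lambda>(Y, \<sigma>). w Y \<sigma> * indicator D \<sigma>) \<in> borel_measurable (\<Psi> \<Otimes>\<^sub>M planted ?V \<mu> \<nu> S)"
          by (simp add: case_prod_beta)
      qed
      finally show ?thesis .
    qed
    have Q_density: "emeasure ?Q D = (\<integral>\<^sup>+\<sigma>. M \<sigma> * indicator D \<sigma> \<partial>?P)" if D: "D \<in> cylinder_sets ?V J" for D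
    proof -
      have Ds: "D \<in> sets (Pi\<^sub>M ?V ?C)" using cylinder_sets_subset[OF J(2)] D by blast
      have "emeasure ?Q D = (\<integral>\<^sup>+Y. emeasure (?L Y) D \<partial>\<Psi>)"
        by (rule emeasure_hidden_ray_law_planted[OF \<Psi> Ds])
      also have "\<dots> = (\<integral>\<^sup>+Y. (\<integral>\<^sup>+\<sigma>. w Y \<sigma> * indicator D \<sigma> \<partial>?P) \<partial>\<Psi>)"
      proof (intro nn_integral_cong)
        fix Y :: "nat \<Rightarrow> 'a"
        have "emeasure (?L Y) D = emeasure (planted ?V \<mu> \<nu> ({} \<union> (J \<inter> range Y))) D"
          using emeasure_planted_cylinder[OF J(1,2) D] by simp
        also have "planted ?V \<mu> \<nu> ({} \<union> (J \<inter> range Y)) = density ?P (w Y)"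
          unfolding w[abs_def] using J \<mu> by (intro planted_Un_eq_density) auto
        also have "emeasure \<dots> D = (\<integral>\<^sup>+\<sigma>. w Y \<sigma> * indicator D \<sigma> \<partial>?P)"
        proof (rule emeasure_density)
          show "w Y \<in> borel_measurable ?P"
            unfolding w[abs_def] measurable_cong_sets[OF sets_P refl]
            using J by (intro borel_measurable_prod_ennreal measurable_label) auto
        qed (simp add: sets_P Ds)
        finally show "emeasure (?L Y) D = (\<integral>\<^sup>+\<sigma>. w Y \<sigma> * indicator D \<sigma> \<partial>?P)" .
      qed
      also have "\<dots> = (\<integral>\<^sup>+\<sigma>. M \<sigma> * indicator D \<sigma> \<partial>?P)"
        by (rule M_Fubini[symmetric]) (simp add: sets_P Ds)
      finally show ?thesis .
    qed
    \<comment> \<open>Writing \<open>M\<close> through the restriction exhibits \<open>B\<close> as a cylinder set over \<open>J\<close>.\<close>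
    define B where "B = {\<sigma> \<in> \<Pi>\<^sub>E v\<in>?V. UNIV. M (restrict \<sigma> J) \<in> {ennreal lam<..}}"
    have B_cyl: "B \<in> cylinder_sets ?V J"
      unfolding B_def using J M_meas[of J] by (intro cylinder_setsI) auto
    have B: "B = {\<sigma> \<in> \<Pi>\<^sub>E v\<in>?V. UNIV. ennreal lam < M \<sigma>}"
      by (simp add: B_def M_def w_restrict)
    have Bs: "B \<in> sets (Pi\<^sub>M ?V ?C)" and As: "A \<in> sets (Pi\<^sub>M ?V ?C)"
      using cylinder_sets_subset[OF J(2)] B_cyl A by blast+
    have LB: "emeasure (?L X) B \<le> ennreal \<delta>" if X: "X \<in> rays T" for X
    proof -
      have inj: "inj X" using X by (simp add: rays_def)
      have at: "(\<Union>k. atypical_labels ?V \<mu> \<nu> \<epsilon> (X ` {..<k + m})) \<in> sets (?L X)"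
        unfolding sets_P using ray_in_verts[OF T X] by (intro sets.countable_UN) (auto intro!: atypical_labels_sets)
      have GX: "G X \<in> sets (?L X)"
        using sets.compl_sets[OF at] by (simp add: G_def)
      have BL: "B \<in> sets (?L X)" by (simp add: sets_P Bs)
      have "ennreal lam * emeasure (?L X) (B \<inter> G X) = (\<integral>\<^sup>+\<sigma>. ennreal lam * indicator (B \<inter> G X) \<sigma> \<partial>?L X)"
        using BL GX by (simp add: nn_integral_cmult_indicator)
      also have "\<dots> \<le> (\<integral>\<^sup>+\<sigma>. M \<sigma> * indicator (G X) \<sigma> \<partial>?L X)"
        by (intro nn_integral_mono) (auto simp: B indicator_def)
      also have "\<dots> = (\<integral>\<^sup>+Y. (\<integral>\<^sup>+\<sigma>. w Y \<sigma> * indicator (G X) \<sigma> \<partial>?L X) \<partial>\<Psi>)"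
        by (rule M_Fubini[OF GX])
      also have "\<dots> \<le> (\<integral>\<^sup>+Y. ennreal K * (1 + ennreal b * (\<Sum>k. ennreal (b ^ k) * indicator (rays_through T (X k)) Y)) \<partial>\<Psi>)"
        unfolding w using b K
        by (intro nn_integral_mono nn_integral_typical_likelihood_le[OF T X _ J \<mu>] typical[OF X])
          (auto simp: \<Psi>D(3))
      also have "\<dots> = ennreal K * (1 + ennreal b * (\<Sum>k. ennreal (b ^ k) * emeasure \<Psi> (rays_through T (X k))))"
        using rays_meas[OF ray_in_verts(1)[OF T X]]
        by (simp add: nn_integral_cmult nn_integral_add nn_integral_suminf nn_integral_cmult_indicator \<Psi>.emeasure_space_1)
      also have "(\<Sum>k. ennreal (b ^ k) * emeasure \<Psi> (rays_through T (X k))) \<le> (\<Sum>k. ennreal (C * (b / \<beta>) ^ k))"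
      proof (intro suminf_le summableI)
        fix k
        have "\<beta> ^ k * \<Psi>.prob (rays_through T (X k)) \<le> C"
          using C[OF ray_in_verts(1)[OF T X], of k] depth_ray[OF T X, of k] by simp
        then have "\<Psi>.prob (rays_through T (X k)) \<le> C / \<beta> ^ k"
          using \<beta>0 by (simp add: field_simps)
        then have "b ^ k * \<Psi>.prob (rays_through T (X k)) \<le> b ^ k * (C / \<beta> ^ k)"
          using b by (intro mult_left_mono) auto
        also have "\<dots> = C * (b / \<beta>) ^ k" by (simp add: power_divide)
        finally show "ennreal (b ^ k) * emeasure \<Psi> (rays_through T (X k)) \<le> ennreal (C * (b / \<beta>) ^ k)"
          using b by (simp add: \<Psi>.emeasure_eq_measure ennreal_mult[symmetric] ennreal_leI)
      qed
      also have "\<dots> = ennreal (C * (1 / (1 - b / \<beta>)))"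
        using b \<beta>0 C0 by (intro suminf_ennreal_eq sums_mult geometric_sums) auto
      also have "ennreal K * (1 + ennreal b * ennreal (C * (1 / (1 - b / \<beta>)))) = ennreal K'"
      proof -
        have "ennreal K * (1 + ennreal b * ennreal x) = ennreal (K * (1 + b * x))" if "x \<ge> 0" for x
          using that b K by (simp add: ennreal_mult)
        moreover have "0 \<le> C * (1 / (1 - b / \<beta>))"
          using b \<beta>0 C0 by (intro mult_nonneg_nonneg) auto
        ultimately show ?thesis
          unfolding K'_def by simp
      qed
      finally have mean: "ennreal lam * emeasure (?L X) (B \<inter> G X) \<le> ennreal K'"
        by (simp add: mult_left_mono add_left_mono)
      have "emeasure (?L X) (B \<inter> G X) \<le> ennreal (\<delta> / 2)"
      proof -
        interpret L: prob_space "?L X" by (rule prob_space_planted)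
        have "lam * L.prob (B \<inter> G X) \<le> K'"
          using mean lam K' by (simp add: L.emeasure_eq_measure ennreal_mult'[symmetric])
        then show ?thesis
          using K' \<delta> by (simp add: L.emeasure_eq_measure lam_def field_simps)
      qed
      moreover have "emeasure (?L X) (\<Union>k. atypical_labels ?V \<mu> \<nu> \<epsilon> (X ` {..<k + m})) \<le> ennreal (\<delta> / 2)"
        using m[OF inj] ray_in_verts(2)[OF T X] by simp
      moreover have "emeasure (?L X) B \<le> emeasure (?L X) (B \<inter> G X) +
          emeasure (?L X) (\<Union>k. atypical_labels ?V \<mu> \<nu> \<epsilon> (X ` {..<k + m}))"
      proof -
        have "emeasure (?L X) B \<le> emeasure (?L X) ((B \<inter> G X) \<union> (\<Union>k. atypical_labels ?V \<mu> \<nu> \<epsilon> (X ` {..<k + m})))"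
          using BL GX at by (intro emeasure_mono) (auto simp: G_def B)
        also have "\<dots> \<le> emeasure (?L X) (B \<inter> G X) + emeasure (?L X) (\<Union>k. atypical_labels ?V \<mu> \<nu> \<epsilon> (X ` {..<k + m}))"
          using BL GX at by (intro emeasure_subadditive) auto
        finally show ?thesis .
      qed
      ultimately have "emeasure (?L X) B \<le> ennreal (\<delta> / 2) + ennreal (\<delta> / 2)"
        by (meson add_mono order_trans)
      also have "\<dots> = ennreal \<delta>"
        using \<delta> by (simp flip: ennreal_plus)
      finally show ?thesis .
    qed
    have QB: "emeasure ?Q B \<le> ennreal \<delta>"
    proof -
      have "emeasure ?Q B = (\<integral>\<^sup>+X. emeasure (?L X) B \<partial>\<Psi>)"
        by (rule emeasure_hidden_ray_law_planted[OF \<Psi> Bs])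
      also have "\<dots> \<le> (\<integral>\<^sup>+X. ennreal \<delta> \<partial>\<Psi>)"
        using LB by (intro nn_integral_mono) (simp add: \<Psi>D(3))
      finally show ?thesis by (simp add: \<Psi>.emeasure_space_1)
    qed
    have "emeasure ?Q A = (\<integral>\<^sup>+\<sigma>. M \<sigma> * indicator A \<sigma> \<partial>?P)"
      by (rule Q_density[OF A])
    also have "\<dots> \<le> (\<integral>\<^sup>+\<sigma>. ennreal lam * indicator A \<sigma> + M \<sigma> * indicator B \<sigma> \<partial>?P)"
    proof (intro nn_integral_mono)
      fix \<sigma> assume "\<sigma> \<in> space ?P"
      then show "M \<sigma> * indicator A \<sigma> \<le> ennreal lam * indicator A \<sigma> + M \<sigma> * indicator B \<sigma>"
        by (cases "\<sigma> \<in> B") (auto simp: B indicator_def not_less add_increasing)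
    qed
    also have "\<dots> = ennreal lam * emeasure ?P A + emeasure ?Q B"
      unfolding Q_density[OF B_cyl] using As Bs
      by (subst nn_integral_add) (auto simp: nn_integral_cmult_indicator sets_P intro!: borel_measurable_times_ennreal)
    also have "\<dots> \<le> ennreal lam * emeasure ?P A + ennreal \<delta>"
      using QB by (intro add_left_mono)
    finally show ?thesis .
  qed
  show ?thesis
  proof (intro exI[of _ lam] conjI allI impI lam)
    fix J and A :: "('a \<Rightarrow> 'o) set"
    assume J: "finite J" "J \<subseteq> ?V" and A: "A \<in> cylinder_sets ?V J"
    obtain J' where J': "finite J'" "J \<subseteq> J'" "J' \<subseteq> ?V" "ray_closed T J'"
      by (rule finite_subset_ray_closed[OF T J])
    then have "A \<in> cylinder_sets ?V J'"
      using cylinder_sets_mono A by blast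
    from main[OF J'(1,3,4) this] show "emeasure ?Q A \<le> ennreal lam * emeasure (background_law T \<mu>) A + ennreal \<delta>"
      by (simp add: background_law_eq_planted[of T \<mu> \<nu>])
  qed
qed

text \<open>
  This approximation carries an estimate that is uniform over the cylinder sets to the whole
  \<open>\<sigma>\<close>-algebra; one approximating set has to serve both laws at once.
\<close>

lemma approximation_by_algebra:
  assumes \<A>: "algebra \<Omega> \<A>" and \<M>: "finite \<M>" "\<And>M. M \<in> \<M> \<Longrightarrow> finite_measure M"
    and sets: "\<And>M. M \<in> \<M> \<Longrightarrow> sets M = sigma_sets \<Omega> \<A>"
    and A: "A \<in> sigma_sets \<Omega> \<A>" and e: "(e::real) > 0"
  shows "\<exists>B\<in>\<A>. \<forall>M\<in>\<M>. measure M ((A - B) \<union> (B - A)) < e"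
  using A e
proof (induction arbitrary: e)
  case (Basic a)
  then show ?case by (intro bexI[of _ a]) auto
next
  case Empty
  interpret algebra \<Omega> \<A> by (rule \<A>)
  show ?case using Empty by (intro bexI[of _ "{}"]) auto
next
  case (Compl a)
  interpret algebra \<Omega> \<A> by (rule \<A>)
  obtain B where B: "B \<in> \<A>" "\<forall>M\<in>\<M>. measure M ((a - B) \<union> (B - a)) < e"
    using Compl.IH[OF Compl.prems] by blast
  have "a \<subseteq> \<Omega>" "B \<subseteq> \<Omega>"
    using sigma_sets_into_sp[OF space_closed Compl.hyps] B(1) sets_into_space by auto
  then have "((\<Omega> - a) - (\<Omega> - B)) \<union> ((\<Omega> - B) - (\<Omega> - a)) = (a - B) \<union> (B - a)"
    by auto
  with B show ?case by (intro bexI[of _ "\<Omega> - B"]) auto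
next
  case (Union A)
  interpret algebra \<Omega> \<A> by (rule \<A>)
  define U where "U n = (\<Union>i<n. A i)" for n :: nat
  have Am: "A i \<in> sets M" if "M \<in> \<M>" for i M
    using Union.hyps that sets by auto
  have Um: "U n \<in> sets M" if "M \<in> \<M>" for n M
    unfolding U_def using Am[OF that] by auto
  have UU: "(\<Union>n. U n) = (\<Union>i. A i)"
    by (auto simp: U_def)
  have "\<forall>\<^sub>F n in sequentially. measure M ((\<Union>i. A i) - U n) < e / 2" if M: "M \<in> \<M>" for M
  proof -
    interpret finite_measure M by (rule \<M>(2)[OF M])
    have "(\<lambda>n. measure M (U n)) \<longlonglongrightarrow> measure M (\<Union>n. U n)"
      using Um[OF M] by (intro finite_Lim_measure_incseq) (auto simp: U_def incseq_def intro: less_le_trans)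
    then have "\<forall>\<^sub>F n in sequentially. measure M (\<Union>n. U n) - e / 2 < measure M (U n)"
      using Union.prems by (intro order_tendstoD) auto
    then show ?thesis
    proof eventually_elim
      case (elim n)
      have "measure M ((\<Union>i. A i) - U n) = measure M (\<Union>i. A i) - measure M (U n)"
        using Am[OF M] Um[OF M] by (intro finite_measure_Diff) (auto simp: U_def)
      with elim show ?case by (simp add: UU)
    qed
  qed
  then have "\<forall>\<^sub>F n in sequentially. \<forall>M\<in>\<M>. measure M ((\<Union>i. A i) - U n) < e / 2"
    using \<M>(1) by (simp add: eventually_ball_finite)
  then obtain n where n: "\<forall>M\<in>\<M>. measure M ((\<Union>i. A i) - U n) < e / 2"
    by (auto simp: eventually_sequentially)
  have "\<exists>B\<in>\<A>. \<forall>M\<in>\<M>. measure M ((A i - B) \<union> (B - A i)) < e / 2 / (n + 1)" for i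
    using Union.IH[of "e / 2 / (n + 1)" i] Union.prems by simp
  then obtain B where B: "\<And>i. B i \<in> \<A>"
    "\<And>i M. M \<in> \<M> \<Longrightarrow> measure M ((A i - B i) \<union> (B i - A i)) < e / 2 / (n + 1)"
    by metis
  let ?B = "\<Union>i<n. B i"
  have "measure M (((\<Union>i. A i) - ?B) \<union> (?B - (\<Union>i. A i))) < e" if M: "M \<in> \<M>" for M
  proof -
    interpret finite_measure M by (rule \<M>(2)[OF M])
    have Bm: "B i \<in> sets M" for i
      using B(1) sets[OF M] by auto
    note [measurable] = Am[OF M] Um[OF M] Bm
    let ?D = "\<lambda>i. (A i - B i) \<union> (B i - A i)"
    have "measure M (((\<Union>i. A i) - ?B) \<union> (?B - (\<Union>i. A i))) \<le> measure M (((\<Union>i. A i) - U n) \<union> (\<Union>i<n. ?D i))"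
      by (intro finite_measure_mono) (auto simp: U_def)
    also have "\<dots> \<le> measure M ((\<Union>i. A i) - U n) + measure M (\<Union>i<n. ?D i)"
      by (intro measure_Un_le) auto
    also have "measure M (\<Union>i<n. ?D i) \<le> (\<Sum>i<n. measure M (?D i))"
      by (intro measure_UNION_le) auto
    also have "\<dots> \<le> (\<Sum>i<n. e / 2 / (n + 1))"
      using B(2)[OF M] by (intro sum_mono less_imp_le)
    also have "\<dots> \<le> e / 2"
      using Union.prems by (simp add: field_simps)
    finally show ?thesis using n M by force
  qed
  moreover have "?B \<in> \<A>" using B(1) by auto
  ultimately show ?case by blast
qed

lemma hidden_ray_law_sets_prob_space:
  assumes "\<Psi> \<in> space (prob_algebra (boundary T))"
  shows "sets (hidden_ray_law T \<mu> \<nu> \<Psi>) = sets (Pi\<^sub>M (verts T) (\<lambda>_. count_space UNIV))"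
    and "prob_space (hidden_ray_law T \<mu> \<nu> \<Psi>)"
proof -
  show "sets (hidden_ray_law T \<mu> \<nu> \<Psi>) = sets (Pi\<^sub>M (verts T) (\<lambda>_. count_space UNIV))"
    using sets_hidden_ray_law[OF assms, of \<mu> \<nu>] sets_planted[of "verts T" \<mu> \<nu> "{}"]
    by (simp add: background_law_eq_planted[of T \<mu> \<nu>])
  show "prob_space (hidden_ray_law T \<mu> \<nu> \<Psi>)"
    unfolding hidden_ray_law_def by (rule prob_space_bind'[OF assms measurable_labels_given_ray])
qed

lemma absolutely_continuous_hidden_ray_law:
  fixes T :: "'a rooted_graph" and \<mu> \<nu> :: "'o::finite pmf" and \<beta> :: real
  assumes T: "rooted_tree T"
    and \<mu>: "\<And>x. pmf \<mu> x > 0" and \<nu>: "\<And>x. pmf \<nu> x > 0"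
    and \<Psi>: "\<Psi> \<in> space (prob_algebra (boundary T))"
    and \<beta>: "exp (relative_entropy \<nu> \<mu>) < \<beta>"
    and C: "\<And>v. v \<in> verts T \<Longrightarrow> \<beta> ^ depth T v * measure \<Psi> (rays_through T v) \<le> C"
  shows "absolutely_continuous (background_law T \<mu>) (hidden_ray_law T \<mu> \<nu> \<Psi>)"
proof -
  let ?P = "background_law T \<mu>" and ?Q = "hidden_ray_law T \<mu> \<nu> \<Psi>"
  let ?\<A> = "(\<Union>J\<in>{J. finite J \<and> J \<subseteq> verts T}. cylinder_sets (verts T) J) :: ('a \<Rightarrow> 'o) set set"
  let ?\<Omega> = "\<Pi>\<^sub>E v\<in>verts T. UNIV :: 'o set"
  interpret P: prob_space ?P
    unfolding background_law_eq_planted[of T \<mu> \<nu>] by (rule prob_space_planted)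
  interpret Q: prob_space ?Q by (rule hidden_ray_law_sets_prob_space[OF \<Psi>])
  have sets_P: "sets ?P = sigma_sets ?\<Omega> ?\<A>" and sets_Q: "sets ?Q = sigma_sets ?\<Omega> ?\<A>"
    by (simp_all add: background_law_eq_planted[of T \<mu> \<nu>] sets_planted hidden_ray_law_sets_prob_space[OF \<Psi>]
        algebra_cylinder_sets(2))
  have "Q.prob N = 0" if N: "N \<in> sets ?P" "P.prob N = 0" for N
  proof -
    have "Q.prob N \<le> 0 + \<delta>" if "\<delta> > 0" for \<delta>
    proof -
      have "\<delta> / 2 > 0" using that by simp
      from hidden_ray_law_cylinder_le[OF T \<mu> \<nu> \<Psi> \<beta> C this]
      obtain lam :: real where lam: "lam > 0" and le: "\<And>J A. finite J \<Longrightarrow> J \<subseteq> verts T \<Longrightarrow> A \<in> cylinder_sets (verts T) J \<Longrightarrow>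
          emeasure ?Q A \<le> ennreal lam * emeasure ?P A + ennreal (\<delta> / 2)"
        by blast
      define e where "e = \<delta> / 2 / (lam + 1)"
      have e: "e > 0" using \<open>\<delta> > 0\<close> lam by (simp add: e_def)
      have "\<exists>B\<in>?\<A>. \<forall>M\<in>{?P, ?Q}. measure M ((N - B) \<union> (B - N)) < e"
        using N(1) e sets_P sets_Q P.finite_measure_axioms Q.finite_measure_axioms
        by (intro approximation_by_algebra[OF algebra_cylinder_sets(1)]) auto
      then obtain B where B: "B \<in> ?\<A>" "P.prob ((N - B) \<union> (B - N)) < e" "Q.prob ((N - B) \<union> (B - N)) < e"
        by auto
      have [measurable]: "B \<in> sets ?P" "B \<in> sets ?Q" "N \<in> sets ?P" "N \<in> sets ?Q"
        using B(1) N(1) sets_P sets_Q by auto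
      have "emeasure ?Q B \<le> ennreal lam * emeasure ?P B + ennreal (\<delta> / 2)"
        using B(1) le by blast
      also have "\<dots> = ennreal (lam * P.prob B + \<delta> / 2)"
        using lam \<open>\<delta> > 0\<close> by (simp add: P.emeasure_eq_measure ennreal_mult)
      finally have QB: "Q.prob B \<le> lam * P.prob B + \<delta> / 2"
        using lam \<open>\<delta> > 0\<close> by (simp add: Q.emeasure_eq_measure del: ennreal_plus)
      have "P.prob B \<le> P.prob (N \<union> ((N - B) \<union> (B - N)))"
        by (intro P.finite_measure_mono) auto
      also have "\<dots> \<le> P.prob N + P.prob ((N - B) \<union> (B - N))"
        by (intro measure_Un_le) auto
      finally have "P.prob B \<le> e" using N(2) B(2) by simp
      moreover have "Q.prob N \<le> Q.prob (B \<union> ((N - B) \<union> (B - N)))"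
        by (intro Q.finite_measure_mono) auto
      moreover have "\<dots> \<le> Q.prob B + Q.prob ((N - B) \<union> (B - N))"
        by (intro measure_Un_le) auto
      ultimately have "Q.prob N \<le> lam * e + \<delta> / 2 + e"
        using QB B(3) mult_left_mono[of "P.prob B" e lam] lam by linarith
      also have "\<dots> = \<delta>"
      proof -
        have "lam + 1 \<noteq> 0" using lam by simp
        then have "e * (lam + 1) = \<delta> / 2"
          using e_def by (subst (asm) nonzero_eq_divide_eq)
        then show ?thesis by (simp add: algebra_simps)
      qed
      finally show ?thesis by simp
    qed
    then have "Q.prob N \<le> 0" by (rule field_le_epsilon)
    then show ?thesis using measure_nonneg[of ?Q N] by linarith
  qed
  then show ?thesis
    unfolding absolutely_continuous_def
    by (auto simp: null_sets_def sets_P sets_Q P.emeasure_eq_measure Q.emeasure_eq_measure)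
qed

section \<open>A zero-one law and the converse absolute continuity\<close>

lemma measurable_relabel:
  assumes "v \<in> V"
  shows "(\<lambda>\<sigma>. \<sigma>(v := a)) \<in> Pi\<^sub>M V (\<lambda>_. count_space UNIV) \<rightarrow>\<^sub>M Pi\<^sub>M V (\<lambda>_. count_space UNIV)"
  using assms by (intro measurable_fun_upd[where J=V]) auto

text \<open>
  Relabelling one vertex turns a null set into a null set, as the new label occurs with positive
  probability independently of the other labels.
\<close>

lemma hidden_ray_law_relabel_null:
  fixes \<mu> \<nu> :: "'o::finite pmf"
  assumes \<mu>: "\<And>x. pmf \<mu> x > 0" and \<nu>: "\<And>x. pmf \<nu> x > 0"
    and \<Psi>: "\<Psi> \<in> space (prob_algebra (boundary T))" and v: "v \<in> verts T"
    and N: "N \<in> sets (Pi\<^sub>M (verts T) (\<lambda>_. count_space UNIV))" "emeasure (hidden_ray_law T \<mu> \<nu> \<Psi>) N = 0"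
  shows "emeasure (hidden_ray_law T \<mu> \<nu> \<Psi>) {\<sigma> \<in> \<Pi>\<^sub>E v\<in>verts T. UNIV. \<sigma>(v := a) \<in> N} = 0"
proof -
  let ?V = "verts T"
  let ?L = "\<lambda>X. planted ?V \<mu> \<nu> (range X)"
  let ?E = "{\<sigma> \<in> \<Pi>\<^sub>E v\<in>?V. UNIV. \<sigma>(v := a) \<in> N}"
  have meas: "(\<lambda>X. emeasure (?L X) D) \<in> borel_measurable \<Psi>"
    if "D \<in> sets (Pi\<^sub>M ?V (\<lambda>_. count_space UNIV))" for D
  proof -
    have "(\<lambda>X. emeasure (labels_given_ray T \<mu> \<nu> X) D) \<in> borel_measurable \<Psi>"
      using \<Psi> that sets_planted[of ?V \<mu> \<nu> "{}"]
      by (intro measurable_emeasure_kernel[OF measurable_prob_algebraD[OF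
            measurable_labels_given_ray[of T \<mu> \<nu>, unfolded measurable_cong_sets[OF
              space_prob_algebra_boundaryD(2)[OF \<Psi>, symmetric] refl]]]])
        (simp add: background_law_eq_planted[of T \<mu> \<nu>])
    then show ?thesis by (simp add: labels_given_ray_eq_planted)
  qed
  have E: "?E \<in> sets (Pi\<^sub>M ?V (\<lambda>_. count_space UNIV))"
  proof -
    have "?E = (\<lambda>\<sigma>. \<sigma>(v := a)) -` N \<inter> space (Pi\<^sub>M ?V (\<lambda>_. count_space UNIV))"
      by (auto simp: space_PiM)
    then show ?thesis using measurable_sets[OF measurable_relabel[OF v] N(1)] by simp
  qed
  have "emeasure (?L X) ?E = 0" if X: "emeasure (?L X) N = 0" for X
  proof -
    let ?M = "\<lambda>u. if u \<in> range X then measure_pmf \<nu> else measure_pmf \<mu>"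
    interpret product_prob_space ?M ?V by (rule product_prob_space_planted)
    have L: "?L X = Pi\<^sub>M ?V ?M" by (simp add: planted_def)
    have "emeasure (?L X) ?E * emeasure (?M v) {a} = emeasure (?L X) {\<sigma> \<in> ?E. \<sigma> v \<in> {a}}"
    proof (unfold L, rule emeasure_coordinate_indep[OF v, symmetric])
      show "?E \<in> sets (Pi\<^sub>M ?V ?M)"
        using E sets_planted[of ?V \<mu> \<nu> "range X"] by (simp add: L)
      fix \<sigma> b assume "\<sigma> \<in> space (Pi\<^sub>M ?V ?M)"
      then have "\<sigma> \<in> (\<Pi>\<^sub>E v\<in>?V. UNIV)"
        using space_planted[of ?V \<mu> \<nu> "range X"] by (simp add: L)
      then show "\<sigma>(v := b) \<in> ?E \<longleftrightarrow> \<sigma> \<in> ?E"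
        using v by (auto simp: PiE_iff extensional_def)
    qed auto
    also have "\<dots> \<le> emeasure (?L X) N"
      using N(1) by (intro emeasure_mono) (auto simp: sets_planted)
    finally have "emeasure (?L X) ?E * emeasure (?M v) {a} = 0" using X by simp
    moreover have "emeasure (?M v) {a} \<noteq> 0"
      using \<mu>[of a] \<nu>[of a] by (simp add: emeasure_pmf_single)
    ultimately show ?thesis by simp
  qed
  moreover have "AE X in \<Psi>. emeasure (?L X) N = 0"
    using N(2) meas[OF N(1)] emeasure_hidden_ray_law_planted[OF \<Psi> N(1), of \<mu> \<nu>]
    by (simp add: nn_integral_0_iff_AE)
  ultimately have "AE X in \<Psi>. emeasure (?L X) ?E = 0"
    by auto
  then have "(\<integral>\<^sup>+X. emeasure (?L X) ?E \<partial>\<Psi>) = 0"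
    using meas[OF E] by (simp add: nn_integral_0_iff_AE)
  then show ?thesis
    by (simp add: emeasure_hidden_ray_law_planted[OF \<Psi> E])
qed

text \<open>
  Kolmogorov's zero-one law in a form suited to null sets: an event that relabelling a single vertex
  cannot enlarge by more than a null set is independent of every finite set of labels, hence of
  itself.
\<close>

lemma zero_one_law_relabel:
  fixes \<mu> :: "'o::finite pmf" and V :: "'a set"
  defines "P \<equiv> Pi\<^sub>M V (\<lambda>_. measure_pmf \<mu>)"
  assumes Z: "Z \<in> sets P"
    and relabel: "\<And>v a. v \<in> V \<Longrightarrow> emeasure P ({\<sigma> \<in> space P. \<sigma>(v := a) \<in> Z} - Z) = 0"
  shows "emeasure P Z = 0 \<or> emeasure P Z = 1"
proof -
  interpret product_prob_space "\<lambda>_::'a. measure_pmf \<mu>" V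
    by (intro product_prob_spaceI measure_pmf.prob_space_axioms)
  have setsP: "sets P = sets (Pi\<^sub>M V (\<lambda>_. count_space UNIV))"
    unfolding P_def by (intro sets_PiM_cong) auto
  have spaceP: "space P = (\<Pi>\<^sub>E v\<in>V. UNIV)"
    by (simp add: P_def space_PiM)
  define R where "R B J = {\<sigma> \<in> space P. \<forall>v\<in>J. \<sigma> v \<in> B v}" for B :: "'a \<Rightarrow> 'o set" and J
  have R: "R B J = prod_emb V (\<lambda>_. measure_pmf \<mu>) J (Pi\<^sub>E J B)" if "J \<subseteq> V" for B J
    using that by (auto simp: R_def spaceP prod_emb_def PiE_iff extensional_def)
  have Rs: "R B J \<in> sets P" if "finite J" "J \<subseteq> V" for B J
    unfolding R[OF that(2)] P_def using that by (intro sets_PiM_I) auto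
  have box: "emeasure P (Z \<inter> R B J) = emeasure P Z * (\<Prod>v\<in>J. emeasure (measure_pmf \<mu>) (B v))"
    if "finite J" "J \<subseteq> V" for B J
    using that
  proof (induction J)
    case empty
    have "Z \<inter> R B {} = Z" using sets.sets_into_space[OF Z] by (auto simp: R_def)
    then show ?case by simp
  next
    case (insert v J)
    then have v: "v \<in> V" and J: "finite J" "J \<subseteq> V" by auto
    \<comment> \<open>\<open>Z'\<close> equals \<open>Z\<close> up to a null set and does not depend on the label of \<open>v\<close>.\<close>
    define Z' where "Z' = (\<Union>a\<in>UNIV. {\<sigma> \<in> space P. \<sigma>(v := a) \<in> Z})"
    have Z's: "{\<sigma> \<in> space P. \<sigma>(v := a) \<in> Z} \<in> sets P" for a
    proof -
      have "{\<sigma> \<in> space P. \<sigma>(v := a) \<in> Z} = (\<lambda>\<sigma>. \<sigma>(v := a)) -` Z \<inter> space (Pi\<^sub>M V (\<lambda>_. count_space UNIV))"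
        using sets_eq_imp_space_eq[OF setsP] by auto
      then show ?thesis
        using measurable_sets[OF measurable_relabel[OF v]] Z setsP by auto
    qed
    then have Z': "Z' \<in> sets P" unfolding Z'_def by (intro sets.finite_UN) auto
    have sub: "Z \<subseteq> Z'"
    proof
      fix \<sigma> assume "\<sigma> \<in> Z"
      then show "\<sigma> \<in> Z'"
        using sets.sets_into_space[OF Z] by (auto simp: Z'_def intro!: exI[of _ "\<sigma> v"])
    qed
    have null: "emeasure P (Z' - Z) = 0"
    proof -
      have "(\<Union>a\<in>UNIV. {\<sigma> \<in> space P. \<sigma>(v := a) \<in> Z} - Z) \<in> null_sets P"
        using relabel[OF v] Z Z's by (intro null_sets.finite_UN) (auto simp: null_sets_def)
      moreover have "Z' - Z = (\<Union>a\<in>UNIV. {\<sigma> \<in> space P. \<sigma>(v := a) \<in> Z} - Z)"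
        by (auto simp: Z'_def)
      ultimately show ?thesis by (simp add: null_sets_def)
    qed
    have same: "emeasure P (Z' \<inter> D) = emeasure P (Z \<inter> D)" if D: "D \<in> sets P" for D
    proof (rule antisym)
      have "emeasure P (Z' \<inter> D) \<le> emeasure P ((Z \<inter> D) \<union> (Z' - Z))"
        using Z Z' D by (intro emeasure_mono) auto
      also have "\<dots> \<le> emeasure P (Z \<inter> D) + emeasure P (Z' - Z)"
        using Z Z' D by (intro emeasure_subadditive) auto
      finally show "emeasure P (Z' \<inter> D) \<le> emeasure P (Z \<inter> D)" using null by simp
      show "emeasure P (Z \<inter> D) \<le> emeasure P (Z' \<inter> D)"
        using Z' D sub by (intro emeasure_mono) auto
    qed
    have "Z' \<inter> R B (insert v J) = {\<sigma> \<in> Z' \<inter> R B J. \<sigma> v \<in> B v}"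
      by (auto simp: R_def)
    then have "emeasure P (Z' \<inter> R B (insert v J)) = emeasure P {\<sigma> \<in> Z' \<inter> R B J. \<sigma> v \<in> B v}"
      by simp
    also have "\<dots> = emeasure P (Z' \<inter> R B J) * emeasure (measure_pmf \<mu>) (B v)"
    proof (unfold P_def, rule emeasure_coordinate_indep[OF v], fold P_def)
      show "Z' \<inter> R B J \<in> sets P" using Z' Rs[OF J] by auto
      fix \<sigma> a assume \<sigma>: "\<sigma> \<in> space P"
      then have upd: "\<sigma>(v := a) \<in> space P"
        using v by (auto simp: spaceP PiE_iff extensional_def)
      show "\<sigma>(v := a) \<in> Z' \<inter> R B J \<longleftrightarrow> \<sigma> \<in> Z' \<inter> R B J"
        using \<sigma> upd insert.hyps(2) by (auto simp: Z'_def R_def)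
    qed simp
    finally show ?case
      using same Rs[OF J] Rs[of "insert v J"] insert.prems J insert.IH insert.hyps
      by (simp add: mult_ac)
  qed
  \<comment> \<open>Independence of all boxes extends to all events, in particular to \<open>Z\<close> itself.\<close>
  have "density P (indicator Z) = scale_measure (emeasure P Z) P"
  proof (rule measure_eqI_PiM_infinite[where I=V and M="\<lambda>_. measure_pmf \<mu>"])
    show "sets (density P (indicator Z)) = sets (Pi\<^sub>M V (\<lambda>_. measure_pmf \<mu>))"
      "sets (scale_measure (emeasure P Z) P) = sets (Pi\<^sub>M V (\<lambda>_. measure_pmf \<mu>))"
      by (simp_all add: P_def)
    have "emeasure (density P (indicator Z)) (space P) = emeasure P (Z \<inter> space P)"
      using Z by (intro emeasure_restricted) auto
    then show "finite_measure (density P (indicator Z))"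
      by (intro finite_measureI) (simp add: P_def)
    fix B :: "'a \<Rightarrow> 'o set" and J assume J: "finite J" "J \<subseteq> V"
    let ?B = "prod_emb V (\<lambda>_. measure_pmf \<mu>) J (Pi\<^sub>E J B)"
    have "emeasure (density P (indicator Z)) ?B = emeasure P (Z \<inter> R B J)"
      using Z Rs[OF J, of B] unfolding R[OF J(2)] by (intro emeasure_restricted) auto
    also have "\<dots> = emeasure P Z * emeasure P ?B"
      unfolding box[OF J] using emeasure_PiM_emb[OF J(2,1), of B] by (simp add: P_def)
    finally show "emeasure (density P (indicator Z)) ?B = emeasure (scale_measure (emeasure P Z) P) ?B"
      by simp
  qed
  then have "emeasure (density P (indicator Z)) Z = emeasure P Z * emeasure P Z"
    by simp
  then have "emeasure P Z = emeasure P Z * emeasure P Z"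
    using Z by (simp add: emeasure_restricted)
  moreover have "emeasure P Z = ennreal (measure P Z)"
    unfolding P_def by (rule P.emeasure_eq_measure)
  ultimately show ?thesis
    by (auto simp: ennreal_mult'[symmetric])
qed

text \<open>
  The zero set of the density of the hidden-ray law is the largest null set of that law, up to a null
  set of the background law. Hence it is stable under relabelling, and the zero-one law leaves no
  room for it.
\<close>

lemma absolutely_continuous_background_law:
  fixes \<mu> \<nu> :: "'o::finite pmf"
  assumes \<mu>: "\<And>x. pmf \<mu> x > 0" and \<nu>: "\<And>x. pmf \<nu> x > 0"
    and \<Psi>: "\<Psi> \<in> space (prob_algebra (boundary T))"
    and ac: "absolutely_continuous (background_law T \<mu>) (hidden_ray_law T \<mu> \<nu> \<Psi>)"
  shows "absolutely_continuous (hidden_ray_law T \<mu> \<nu> \<Psi>) (background_law T \<mu>)"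
proof -
  let ?P = "background_law T \<mu>" and ?Q = "hidden_ray_law T \<mu> \<nu> \<Psi>"
  interpret P: prob_space ?P
    unfolding background_law_eq_planted[of T \<mu> \<nu>] by (rule prob_space_planted)
  interpret Q: prob_space ?Q by (rule hidden_ray_law_sets_prob_space[OF \<Psi>])
  have setsP: "sets ?P = sets (Pi\<^sub>M (verts T) (\<lambda>_. count_space UNIV))"
    by (simp add: background_law_eq_planted[of T \<mu> \<nu>] sets_planted)
  have spaceP: "space ?P = (\<Pi>\<^sub>E v\<in>verts T. UNIV)"
    using space_planted[of "verts T" \<mu> \<nu> "{}"] by (simp add: background_law_eq_planted[of T \<mu> \<nu>])
  have setsQ: "sets ?Q = sets ?P"
    using setsP hidden_ray_law_sets_prob_space(1)[OF \<Psi>] by simp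
  obtain f where f [measurable]: "f \<in> borel_measurable ?P" and fQ: "density ?P f = ?Q"
    using P.Radon_Nikodym[OF ac setsQ] by blast
  define Z where "Z = {\<sigma> \<in> space ?P. f \<sigma> = 0}"
  have Z [measurable]: "Z \<in> sets ?P" unfolding Z_def by measurable
  have QZ: "emeasure ?Q Z = 0"
  proof -
    have "Z \<in> null_sets (density ?P f)"
      using Z by (subst null_sets_density_iff) (auto simp: Z_def)
    then show ?thesis by (simp add: fQ null_sets_def)
  qed
  have maximal: "emeasure ?P (N - Z) = 0" if N: "N \<in> sets ?P" "emeasure ?Q N = 0" for N
  proof -
    have "N \<in> null_sets (density ?P f)" using N by (simp add: fQ null_sets_def setsQ)
    then have "AE \<sigma> in ?P. \<sigma> \<in> N \<longrightarrow> f \<sigma> = 0"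
      by (simp add: null_sets_density_iff)
    then have "AE \<sigma> in ?P. \<sigma> \<notin> N - Z"
      by (rule AE_mp) (auto simp: Z_def intro!: AE_I2)
    moreover have "{\<sigma> \<in> space ?P. \<not> \<sigma> \<notin> N - Z} = N - Z"
      using sets.sets_into_space[OF N(1)] by auto
    ultimately show ?thesis
      using N(1) by (subst (asm) AE_iff_measurable[of "N - Z"]) auto
  qed
  have "emeasure ?P Z = 0 \<or> emeasure ?P Z = 1"
    unfolding background_law_def
  proof (rule zero_one_law_relabel, fold background_law_def)
    fix v a assume v: "v \<in> verts T"
    let ?E = "{\<sigma> \<in> space ?P. \<sigma>(v := a) \<in> Z}"
    have "emeasure ?Q ?E = 0"
      using hidden_ray_law_relabel_null[OF \<mu> \<nu> \<Psi> v _ QZ, of a] Z by (simp add: setsP spaceP)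
    moreover have "?E \<in> sets ?P"
    proof -
      have "?E = (\<lambda>\<sigma>. \<sigma>(v := a)) -` Z \<inter> space (Pi\<^sub>M (verts T) (\<lambda>_. count_space UNIV))"
        using sets_eq_imp_space_eq[OF setsP] by auto
      then show ?thesis
        using measurable_sets[OF measurable_relabel[OF v]] Z setsP by auto
    qed
    ultimately show "emeasure ?P (?E - Z) = 0" by (intro maximal)
  qed (rule Z)
  moreover have "emeasure ?P Z \<noteq> 1"
  proof
    assume "emeasure ?P Z = 1"
    then have "P.prob (space ?P - Z) = 0"
      using P.prob_compl[OF Z] by (simp add: P.emeasure_eq_measure)
    then have "space ?P - Z \<in> null_sets ?P"
      using Z by (simp add: null_sets_def P.emeasure_eq_measure)
    then have "space ?P - Z \<in> null_sets ?Q"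
      using ac by (auto simp: absolutely_continuous_def)
    then have "(space ?P - Z) \<union> Z \<in> null_sets ?Q"
      using QZ Z by (intro null_sets.Un) (auto simp: null_sets_def setsQ)
    moreover have "(space ?P - Z) \<union> Z = space ?Q"
      using sets.sets_into_space[OF Z] sets_eq_imp_space_eq[OF setsQ] by auto
    ultimately show False
      using Q.emeasure_space_1 by (simp add: null_sets_def)
  qed
  ultimately have PZ: "emeasure ?P Z = 0" by blast
  show ?thesis
    unfolding absolutely_continuous_def
  proof
    fix N assume "N \<in> null_sets ?Q"
    then have N: "N \<in> sets ?P" "emeasure ?Q N = 0"
      by (auto simp: null_sets_def setsQ)
    have "emeasure ?P N \<le> emeasure ?P ((N - Z) \<union> Z)"
      using N(1) Z by (intro emeasure_mono) auto
    also have "\<dots> \<le> emeasure ?P (N - Z) + emeasure ?P Z"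
      using N(1) Z by (intro emeasure_subadditive) auto
    finally show "N \<in> null_sets ?P"
      using maximal[OF N] PZ N(1) by (simp add: null_sets_def)
  qed
qed

section \<open>The dichotomy at the entropy threshold\<close>

lemma ln_ereal_less_imp:
  assumes "ln_ereal x < ereal h"
  obtains \<beta> :: real where "\<beta> > 0" "x < ereal \<beta>" "\<beta> < exp h"
proof (cases "x \<le> 0")
  case True
  have "x < ereal (exp h / 2)"
    using True by (rule le_less_trans) simp
  with that[of "exp h / 2"] show ?thesis by simp
next
  case False
  then obtain r where r: "x = ereal r" "r > 0"
    using assms by (cases x) (auto simp: ln_ereal_def)
  then have "ln r < h" using assms by (simp add: ln_ereal_def)
  then have "r < exp h" using r(2) by (metis exp_less_cancel_iff exp_ln)
  then obtain \<beta> where "r < \<beta>" "\<beta> < exp h" using dense by blast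
  with r that[of \<beta>] show ?thesis by simp
qed

lemma less_ln_ereal_imp:
  assumes "ereal h < ln_ereal x"
  shows "ereal (exp h) < x"
proof (cases "x = \<infinity>")
  case False
  then obtain r where r: "x = ereal r" "r > 0"
    using assms by (cases x) (auto simp: ln_ereal_def split: if_splits)
  then have "h < ln r" using assms by (simp add: ln_ereal_def)
  then have "exp h < r" using r(2) by (metis exp_less_cancel_iff exp_ln)
  with r show ?thesis by simp
qed simp

theorem theorem1p7:
  fixes T :: "'a rooted_graph" and \<mu> \<nu> :: "'o::finite pmf"
  assumes "rooted_tree T" and "infinite (verts T)"
    and "\<And>v. v \<in> verts T \<Longrightarrow> v \<noteq> root T \<Longrightarrow> \<not> leaf T v"
    and "\<mu> \<noteq> \<nu>"
    and "\<And>\<omega>. pmf \<mu> \<omega> > 0" and "\<And>\<omega>. pmf \<nu> \<omega> > 0"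
  shows "(ln_ereal (branching_number T) < ereal (relative_entropy \<nu> \<mu>) \<longrightarrow>
            (\<forall>\<Psi> \<in> space (prob_algebra (boundary T)).
               mutually_singular (background_law T \<mu>) (hidden_ray_law T \<mu> \<nu> \<Psi>))) \<and>
         (ln_ereal (branching_number T) > ereal (relative_entropy \<nu> \<mu>) \<longrightarrow>
            (\<exists>\<Psi> \<in> space (prob_algebra (boundary T)).
               indistinguishable (background_law T \<mu>) (hidden_ray_law T \<mu> \<nu> \<Psi>)))"
proof (intro conjI impI ballI)
  fix \<Psi> assume \<Psi>: "\<Psi> \<in> space (prob_algebra (boundary T))"
    and "ln_ereal (branching_number T) < ereal (relative_entropy \<nu> \<mu>)"
  then obtain \<beta> :: real where "\<beta> > 0" "branching_number T < ereal \<beta>" "\<beta> < exp (relative_entropy \<nu> \<mu>)"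
    by (elim ln_ereal_less_imp)
  then show "mutually_singular (background_law T \<mu>) (hidden_ray_law T \<mu> \<nu> \<Psi>)"
    by (intro mutually_singular_hidden_ray_law assms \<Psi>)
next
  assume "ln_ereal (branching_number T) > ereal (relative_entropy \<nu> \<mu>)"
  then have "ereal (exp (relative_entropy \<nu> \<mu>)) < branching_number T"
    by (rule less_ln_ereal_imp)
  then obtain \<beta> \<Psi> where \<beta>: "exp (relative_entropy \<nu> \<mu>) < \<beta>"
    and \<Psi>: "\<Psi> \<in> space (prob_algebra (boundary T))"
    and bdd: "bdd_above ((\<lambda>v. \<beta> ^ depth T v * measure \<Psi> (rays_through T v)) ` verts T)"
    unfolding branching_number_def less_Sup_iff by auto
  obtain C where C: "\<And>v. v \<in> verts T \<Longrightarrow> \<beta> ^ depth T v * measure \<Psi> (rays_through T v) \<le> C"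
    using bdd unfolding bdd_above_def by blast
  have ac: "absolutely_continuous (background_law T \<mu>) (hidden_ray_law T \<mu> \<nu> \<Psi>)"
    by (rule absolutely_continuous_hidden_ray_law[OF assms(1,5,6) \<Psi> \<beta> C])
  then have "indistinguishable (background_law T \<mu>) (hidden_ray_law T \<mu> \<nu> \<Psi>)"
    unfolding indistinguishable_def
    using absolutely_continuous_background_law[OF assms(5,6) \<Psi> ac] by blast
  with \<Psi> show "\<exists>\<Psi>\<in>space (prob_algebra (boundary T)).
      indistinguishable (background_law T \<mu>) (hidden_ray_law T \<mu> \<nu> \<Psi>)" by blast
qed

end
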